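(* Let $n \geq 1$ and $1 \leq d \leq n$ be integers, let $\Gamma$ be a closed subset of $\mathbf{R}^n$, let $G$ be an abelian group (the coefficient group of Čech homology), and let $L$ be a subgroup of the Čech homology group $H_{d-1}(\Gamma) = H_{d-1}(\Gamma;G)$. Let $(E_k)$ be a sequence of Reifenberg competitors in $\mathbf{R}^n$ and let $E$ be a compact subset of $\mathbf{R}^n$. Assume that 1. there exists a compact set $C \subset \mathbf{R}^n$ such that for all $k$, $E_k \subset C$; 2. for all open sets $V \subset \mathbf{R}^n$ containing $E \cup \Gamma$, $$\lim_{k} \mathcal{H}^d(E_k \setminus V) = 0.$$ Then $E$ is a Reifenberg competitor.
   Context: Čech homology: for a topological space $S$, an integer $k$ and an abelian group $G$, $H_k(S;G)$ (abbreviated $H_k(S)$) denotes the $k$th (unreduced) Čech homology group of $S$ over $G$ in the sense of Eilenberg–Steenrod, i.e. the inverse limit, over the open coverings of $S$ directed by refinement, of the simplicial homology groups with coefficients in $G$ of the nerves of the coverings. No restriction is placed on the abelian group $G$. Reifenberg competitor (with respect to $\Gamma$ and $L$): a compact subset $E \subset \mathbf{R}^n$ such that the morphism $H_{d-1}(\Gamma) \to H_{d-1}(E \cup \Gamma)$ induced by inclusion is zero on $L$. $\mathcal{H}^d$ denotes the $d$-dimensional Hausdorff measure. *)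

theory Defs
  imports "HOL-Analysis.Analysis" "HOL-Algebra.Product_Groups"
begin

section \<open>Simplicial homology with coefficients in an abelian group\<close>

text \<open>
  An abstract simplicial complex is given by the set of its (finite, nonempty) simplices.
  A \<open>k\<close>-chain is a finitely supported function on the oriented \<open>k\<close>-simplices that changes sign
  when the orientation is reversed. It is encoded as a function \<open>c\<close> on lists of vertices that
  vanishes on lists that do not enumerate a \<open>k\<close>-simplex without repetition and changes sign under
  adjacent transpositions, and hence under all odd permutations. The value of \<open>c\<close> at such a list
  is the coefficient of the corresponding oriented simplex.
\<close>

definition oriented_chains :: "nat \<Rightarrow> 'v set set \<Rightarrow> ('v list \<Rightarrow> 'g::ab_group_add) set" where
  "oriented_chains k K =
    {c. finite {vs. c vs \<noteq> 0} \<and>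
        (\<forall>vs. c vs \<noteq> 0 \<longrightarrow> length vs = Suc k \<and> distinct vs \<and> set vs \<in> K) \<and>
        (\<forall>xs a b ys. c (xs @ a # b # ys) = - c (xs @ b # a # ys))}"

text \<open>
  This is \<open>\<partial>[v\<^sub>0,\<dots>,v\<^sub>k] = (\<Sum>i\<le>k. (-1)^i [v\<^sub>0,\<dots>,v\<^sub>i\<^sub>-\<^sub>1,v\<^sub>i\<^sub>+\<^sub>1,\<dots>,v\<^sub>k])\<close> read off coefficientwise: the oriented
  simplices having \<open>ws\<close> as a face with incidence number \<open>1\<close> are the \<open>v # ws\<close>. The boundary of a
  \<open>0\<close>-chain is zero (unreduced homology), whence the case of the empty list.
\<close>

definition boundary :: "('v list \<Rightarrow> 'g::ab_group_add) \<Rightarrow> 'v list \<Rightarrow> 'g" where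
  "boundary c ws = (if ws = [] then 0 else \<Sum>v | c (v # ws) \<noteq> 0. c (v # ws))"

text \<open>
  The chain map of a simplicial map \<open>p\<close>, \<open>[v\<^sub>0,\<dots>,v\<^sub>k] \<mapsto> [p v\<^sub>0,\<dots>,p v\<^sub>k]\<close>. At a list with a repetition the
  terms cancel in pairs, so degenerate images contribute nothing.
\<close>

definition push_chain :: "('v \<Rightarrow> 'w) \<Rightarrow> ('v list \<Rightarrow> 'g::ab_group_add) \<Rightarrow> 'w list \<Rightarrow> 'g" where
  "push_chain p c ws = (\<Sum>vs | map p vs = ws \<and> c vs \<noteq> 0. c vs)"

definition cycle_group :: "nat \<Rightarrow> 'v set set \<Rightarrow> ('v list \<Rightarrow> 'g::ab_group_add) monoid" where
  "cycle_group k K =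
    \<lparr>carrier = {c \<in> oriented_chains k K. boundary c = (\<lambda>_. 0)},
     monoid.mult = (\<lambda>c c' vs. c vs + c' vs),
     one = (\<lambda>_. 0)\<rparr>"

definition boundaries :: "nat \<Rightarrow> 'v set set \<Rightarrow> ('v list \<Rightarrow> 'g::ab_group_add) set" where
  "boundaries k K = boundary ` oriented_chains (Suc k) K"

definition simplicial_homology ::
    "nat \<Rightarrow> 'v set set \<Rightarrow> ('v list \<Rightarrow> 'g::ab_group_add) set monoid" where
  "simplicial_homology k K = cycle_group k K Mod boundaries k K"

text \<open>
  The map in homology induced by a simplicial map \<open>p\<close> into the complex \<open>L\<close>, on homology classes as
  cosets; the cosets in the union coincide.
\<close>

definition simplicial_induced ::
    "nat \<Rightarrow> 'w set set \<Rightarrow> ('v \<Rightarrow> 'w) \<Rightarrow>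
     ('v list \<Rightarrow> 'g::ab_group_add) set \<Rightarrow> ('w list \<Rightarrow> 'g) set" where
  "simplicial_induced k L p X = (\<Union>z\<in>X. boundaries k L #>\<^bsub>cycle_group k L\<^esub> push_chain p z)"


section \<open>Cech homology\<close>

text \<open>
  A cover is a set of open sets rather than an indexed family. An indexed family and its range refine
  each other, so the inverse limit is the same up to canonical isomorphism.
\<close>

definition open_covers :: "'a topology \<Rightarrow> 'a set set set" where
  "open_covers X = {\<U>. (\<forall>U\<in>\<U>. openin X U) \<and> \<Union>\<U> = topspace X}"

definition refines :: "'a set set \<Rightarrow> 'a set set \<Rightarrow> bool" where
  "refines \<U> \<V> \<longleftrightarrow> (\<forall>U\<in>\<U>. \<exists>V\<in>\<V>. U \<subseteq> V)"

definition nerve :: "'a set set \<Rightarrow> 'a set set set" where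
  "nerve \<U> = {\<sigma>. finite \<sigma> \<and> \<sigma> \<noteq> {} \<and> \<sigma> \<subseteq> \<U> \<and> \<Inter>\<sigma> \<noteq> {}}"

text \<open>
  Any two projections of a refinement are contiguous, so the induced map does not depend on the one
  that is chosen.
\<close>

definition refinement_map ::
    "nat \<Rightarrow> 'a set set \<Rightarrow> 'a set set \<Rightarrow>
     ('a set list \<Rightarrow> 'g::ab_group_add) set \<Rightarrow> ('a set list \<Rightarrow> 'g) set" where
  "refinement_map k \<U> \<V> =
    simplicial_induced k (nerve \<V>) (SOME p. \<forall>U\<in>\<U>. p U \<in> \<V> \<and> U \<subseteq> p U)"

text \<open>
  The inverse limit, as the group of compatible families (with pointwise operations) indexed by the
  open covers of the space. The coefficient group is the type \<open>'g\<close>.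
\<close>

definition cech_homology ::
    "nat \<Rightarrow> 'a topology \<Rightarrow> ('a set set \<Rightarrow> ('a set list \<Rightarrow> 'g::ab_group_add) set) monoid" where
  "cech_homology k X =
    (let P = product_group (open_covers X) (\<lambda>\<U>. simplicial_homology k (nerve \<U>))
     in P\<lparr>carrier := {x \<in> carrier P.
           \<forall>\<U>\<in>open_covers X. \<forall>\<V>\<in>open_covers X.
             refines \<U> \<V> \<longrightarrow> refinement_map k \<U> \<V> (x \<U>) = x \<V>}\<rparr>)"

definition preimage_cover :: "'a topology \<Rightarrow> ('a \<Rightarrow> 'b) \<Rightarrow> 'b set set \<Rightarrow> 'a set set" where
  "preimage_cover X f \<V> = (\<lambda>V. f -` V \<inter> topspace X) ` \<V>"

text \<open>
  For a continuous map \<open>f\<close> from \<open>X\<close> to \<open>Y\<close>. A vertex of the nerve of the preimage cover may be the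
  preimage of several members of \<open>\<V>\<close>; the resulting simplicial maps are again contiguous.
\<close>

definition cech_induced ::
    "nat \<Rightarrow> 'a topology \<Rightarrow> 'b topology \<Rightarrow> ('a \<Rightarrow> 'b) \<Rightarrow>
     ('a set set \<Rightarrow> ('a set list \<Rightarrow> 'g::ab_group_add) set) \<Rightarrow>
     ('b set set \<Rightarrow> ('b set list \<Rightarrow> 'g) set)" where
  "cech_induced k X Y f x =
    (\<lambda>\<V>\<in>open_covers Y.
      simplicial_induced k (nerve \<V>)
        (SOME p. \<forall>U\<in>preimage_cover X f \<V>. p U \<in> \<V> \<and> f -` p U \<inter> topspace X = U)
        (x (preimage_cover X f \<V>)))"


section \<open>Hausdorff measure\<close>

text \<open>
  The supremum over \<open>\<delta>\<close> is the limit as \<open>\<delta>\<close> tends to \<open>0\<close>, the infimum being antitone in \<open>\<delta>\<close>.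
  Boundedness is required because \<^const>\<open>diameter\<close> is a junk value on unbounded sets; the empty set
  counts \<open>0\<close> also when \<open>d = 0\<close>. The normalization makes the measure agree with Lebesgue measure on
  \<open>d\<close>-dimensional Euclidean space.
\<close>

definition hausdorff_measure :: "nat \<Rightarrow> 'a::metric_space set \<Rightarrow> ennreal" where
  "hausdorff_measure d S =
    ennreal (unit_ball_vol (real d) / 2 ^ d) *
    (SUP \<delta>\<in>{0::real<..}.
      INF A\<in>{A :: nat \<Rightarrow> 'a set. S \<subseteq> (\<Union>i. A i) \<and> (\<forall>i. bounded (A i) \<and> diameter (A i) \<le> \<delta>)}.
        \<Sum>i. if A i = {} then 0 else ennreal (diameter (A i) ^ d))"


section \<open>Reifenberg competitors\<close>

definition reifenberg_competitor ::
    "nat \<Rightarrow> 'a::topological_space set \<Rightarrow>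
     ('a set set \<Rightarrow> ('a set list \<Rightarrow> 'g::ab_group_add) set) set \<Rightarrow> 'a set \<Rightarrow> bool" where
  "reifenberg_competitor d \<Gamma> L E \<longleftrightarrow>
    compact E \<and>
    (\<forall>x\<in>L. cech_induced (d - 1) (top_of_set \<Gamma>) (top_of_set (E \<union> \<Gamma>)) (\<lambda>y. y) x
            = \<one>\<^bsub>cech_homology (d - 1) (top_of_set (E \<union> \<Gamma>))\<^esub>)"

end

theory Submission
  imports Defs
begin

text \<open>
  Fix a cover \<open>\<V>\<close> of \<open>Y = E \<union> \<Gamma>\<close>. Its members extend to open subsets of the whole space without
  creating new simplices of the nerve, and the extensions cover a neighbourhood of \<open>Y\<close>. Choose a
  slightly smaller neighbourhood \<open>W\<close>. For large \<open>k\<close> the part of \<open>E\<^sub>k\<close> outside \<open>W\<close> has so small a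
  \<open>d\<close>-dimensional measure that it has an open cover of small mesh and of order at most \<open>d\<close>, obtained
  from balls of generic radii. Combine this with the cover of the part of \<open>E\<^sub>k \<union> \<Gamma>\<close> inside \<open>W\<close> by
  the extended members of \<open>\<V>\<close>. Since \<open>E\<^sub>k\<close> is a competitor, the given class bounds a \<open>d\<close>-chain in the
  nerve of the combined cover. All the \<open>d\<close>-simplices of this nerve have vertices meeting \<open>W\<close> only, as
  the others would consist of \<open>d + 1\<close> members of the cover of order at most \<open>d\<close>. So the chain can be
  mapped to the nerve of \<open>\<V>\<close>.
\<close>

section \<open>Chains\<close>

text \<open>Chain maps are pushforwards along \<open>map p\<close>, and boundaries at nonempty lists
  are pushforwards along \<open>tl\<close>. Functoriality and additivity thus serve for
  both.\<close>

definition pushforward :: "('a \<Rightarrow> 'b) \<Rightarrow> ('a \<Rightarrow> 'g::ab_group_add) \<Rightarrow> 'b \<Rightarrow> 'g" where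
  "pushforward \<phi> c b = (\<Sum>a | \<phi> a = b \<and> c a \<noteq> 0. c a)"

text \<open>The index set in the definition depends on \<open>c\<close> and \<open>b\<close>; a
  common finite set \<open>F\<close> allows sums for several functions to be compared.\<close>

lemma pushforward_eq_sum:
  assumes "finite F" "{a. c a \<noteq> 0} \<subseteq> F"
  shows "pushforward \<phi> c b = (\<Sum>a\<in>F. if \<phi> a = b then c a else 0)"
proof -
  have "(\<Sum>a\<in>F. if \<phi> a = b then c a else 0) = (\<Sum>a | \<phi> a = b \<and> c a \<noteq> 0. if \<phi> a = b then c a else 0)"
    using assms by (intro sum.mono_neutral_right) auto
  also have "\<dots> = pushforward \<phi> c b"
    unfolding pushforward_def by (intro sum.cong) auto
  finally show ?thesis by simp
qed

lemma support_pushforward: "{b. pushforward \<phi> c b \<noteq> 0} \<subseteq> \<phi> ` {a. c a \<noteq> 0}"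
proof -
  have "\<exists>a. \<phi> a = b \<and> c a \<noteq> 0" if "pushforward \<phi> c b \<noteq> 0" for b
    using sum.not_neutral_contains_not_neutral[OF that[unfolded pushforward_def]] by blast
  then show ?thesis by blast
qed

lemma pushforward_compose:
  assumes "finite {a. c a \<noteq> 0}"
  shows "pushforward \<psi> (pushforward \<phi> c) = pushforward (\<psi> \<circ> \<phi>) c"
proof
  fix z
  let ?F = "{a. c a \<noteq> 0}"
  have "pushforward \<psi> (pushforward \<phi> c) z
      = (\<Sum>y\<in>\<phi> ` ?F. if \<psi> y = z then pushforward \<phi> c y else 0)"
    by (intro pushforward_eq_sum finite_imageI assms support_pushforward)
  also have "\<dots> = (\<Sum>y\<in>\<phi> ` ?F. \<Sum>a | a \<in> ?F \<and> \<phi> a = y. if \<psi> (\<phi> a) = z then c a else 0)"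
    unfolding pushforward_def by (intro sum.cong refl) (auto intro!: sum.cong)
  also have "\<dots> = (\<Sum>a\<in>?F. if \<psi> (\<phi> a) = z then c a else 0)"
    using assms by (intro sum.image_gen[symmetric])
  also have "\<dots> = pushforward (\<psi> \<circ> \<phi>) c z"
    using pushforward_eq_sum[OF assms order_refl, of "\<psi> \<circ> \<phi>" z] by simp
  finally show "pushforward \<psi> (pushforward \<phi> c) z = pushforward (\<psi> \<circ> \<phi>) c z" .
qed

lemma pushforward_add:
  assumes "finite {a. c a \<noteq> 0}" "finite {a. c' a \<noteq> 0}"
  shows "pushforward \<phi> (\<lambda>a. c a + c' a) = (\<lambda>b. pushforward \<phi> c b + pushforward \<phi> c' b)"
proof
  fix b
  let ?F = "{a. c a \<noteq> 0} \<union> {a. c' a \<noteq> 0}"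
  have fin: "finite ?F"
    using assms by simp
  have "pushforward \<phi> (\<lambda>a. c a + c' a) b = (\<Sum>a\<in>?F. if \<phi> a = b then c a + c' a else 0)"
    using fin by (intro pushforward_eq_sum) auto
  also have "\<dots> = (\<Sum>a\<in>?F. if \<phi> a = b then c a else 0) + (\<Sum>a\<in>?F. if \<phi> a = b then c' a else 0)"
    by (subst sum.distrib[symmetric]) (auto intro!: sum.cong)
  also have "\<dots> = pushforward \<phi> c b + pushforward \<phi> c' b"
    using fin by (subst (1 2) pushforward_eq_sum[where F = ?F]) auto
  finally show "pushforward \<phi> (\<lambda>a. c a + c' a) b = pushforward \<phi> c b + pushforward \<phi> c' b" .
qed

lemma pushforward_uminus: "pushforward \<phi> (\<lambda>a. - c a) = (\<lambda>b. - pushforward \<phi> c b)"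
  by (auto simp: pushforward_def sum_negf fun_eq_iff)

lemma pushforward_zero: "pushforward \<phi> (\<lambda>_. 0) = (\<lambda>_. 0)"
  by (simp add: pushforward_def fun_eq_iff)

lemma pushforward_cong:
  assumes "\<And>a. c a \<noteq> 0 \<Longrightarrow> \<phi> a = \<psi> a"
  shows "pushforward \<phi> c = pushforward \<psi> c"
  unfolding pushforward_def using assms by (intro ext sum.cong) auto

lemma push_chain_eq: "push_chain p c = pushforward (map p) c"
  by (simp add: push_chain_def pushforward_def fun_eq_iff)

text \<open>Over a nonempty \<open>ws\<close> the fibre of \<open>tl\<close> consists of the lists
  \<open>v # ws\<close>. At the empty list the pushforward of a 0-chain would be its augmentation,
  which the unreduced boundary omits.\<close>

lemma boundary_eq: "boundary c = (\<lambda>ws. if ws = [] then 0 else pushforward tl c ws)"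
proof
  fix ws
  have "(\<Sum>v | c (v # ws) \<noteq> 0. c (v # ws)) = pushforward tl c ws" if "ws \<noteq> []"
  proof -
    have *: "{vs. tl vs = ws \<and> c vs \<noteq> 0} = (\<lambda>v. v # ws) ` {v. c (v # ws) \<noteq> 0}"
    proof (intro equalityI subsetI)
      fix vs assume "vs \<in> {vs. tl vs = ws \<and> c vs \<noteq> 0}"
      then show "vs \<in> (\<lambda>v. v # ws) ` {v. c (v # ws) \<noteq> 0}"
        using that by (cases vs) auto
    qed auto
    show ?thesis
      unfolding pushforward_def * by (subst sum.reindex) (auto simp: inj_on_def)
  qed
  then show "boundary c ws = (if ws = [] then 0 else pushforward tl c ws)"
    by (simp add: boundary_def)
qed

text \<open>\<open>tl\<close> commutes with \<open>map p\<close>, so this is functoriality of the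
  pushforward.\<close>

lemma boundary_push_chain:
  assumes "finite {vs. c vs \<noteq> 0}"
  shows "boundary (push_chain p c) = push_chain p (boundary c)"
proof
  fix ws
  show "boundary (push_chain p c) ws = push_chain p (boundary c) ws"
  proof (cases "ws = []")
    case True
    then show ?thesis
      by (simp add: boundary_def push_chain_def)
  next
    case False
    have "boundary (push_chain p c) ws = pushforward (tl \<circ> map p) c ws"
      using assms False by (simp add: boundary_eq push_chain_eq pushforward_compose)
    also have "\<dots> = pushforward (map p \<circ> tl) c ws"
      by (rule arg_cong[where f = "\<lambda>\<phi>. pushforward \<phi> c ws"]) (auto simp: map_tl)
    also have "\<dots> = pushforward (map p) (pushforward tl c) ws"
      using assms by (simp add: pushforward_compose)
    \<comment> \<open>A preimage of the nonempty list \<open>ws\<close> under \<open>map p\<close>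
      is nonempty, so the exceptional value of \<open>boundary\<close> does not enter.\<close>
    also have "\<dots> = push_chain p (boundary c) ws"
      unfolding push_chain_eq boundary_eq pushforward_def[of "map p"]
      using False by (intro sum.cong) auto
    finally show ?thesis .
  qed
qed

lemma boundary_add:
  assumes "finite {a. c a \<noteq> 0}" "finite {a. c' a \<noteq> 0}"
  shows "boundary (\<lambda>a. c a + c' a) = (\<lambda>b. boundary c b + boundary c' b)"
  using assms by (auto simp: boundary_eq pushforward_add)

lemma boundary_uminus: "boundary (\<lambda>a. - c a) = (\<lambda>b. - boundary c b)"
  by (auto simp: boundary_eq pushforward_uminus)

lemma boundary_zero: "boundary (\<lambda>_. 0) = (\<lambda>_. 0)"
  by (auto simp: boundary_eq pushforward_zero)

section \<open>Antisymmetry and chain maps\<close>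

text \<open>The terms cancel in pairs \<open>a\<close>, \<open>h a\<close>. Arguing from
  \<open>sum f A = - sum f A\<close> would fail in a group with elements of order two.\<close>

lemma sum_sign_reversing_involution:
  fixes f :: "'a \<Rightarrow> 'g::ab_group_add"
  assumes "finite A"
    and "\<And>a. a \<in> A \<Longrightarrow> h a \<in> A \<and> h (h a) = a \<and> h a \<noteq> a \<and> f (h a) = - f a"
  shows "sum f A = 0"
  using assms
proof (induction A rule: finite_psubset_induct)
  case (psubset A)
  show ?case
  proof (cases "A = {}")
    case False
    then obtain a where a: "a \<in> A" by blast
    have ha: "h a \<in> A" "h (h a) = a" "h a \<noteq> a" "f (h a) = - f a"
      using psubset.prems[OF a] by auto
    let ?B = "A - {a, h a}"
    have "sum f ?B = 0"
    proof (rule psubset.IH)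
      show "?B \<subset> A"
        using a by blast
      fix b assume b: "b \<in> ?B"
      have "h b \<noteq> a" "h b \<noteq> h a"
        using psubset.prems[of b] b ha by auto
      then show "h b \<in> ?B \<and> h (h b) = b \<and> h b \<noteq> b \<and> f (h b) = - f b"
        using psubset.prems[of b] b by auto
    qed
    moreover have "sum f A = sum f ?B + sum f {a, h a}"
      using psubset.hyps a ha by (intro sum.subset_diff) auto
    ultimately show ?thesis
      using ha by auto
  qed simp
qed

text \<open>Being the identity on lists that are too short, it is an involution commuting with
  \<open>map p\<close> on all lists.\<close>

definition swap_adj :: "nat \<Rightarrow> 'a list \<Rightarrow> 'a list" where
  "swap_adj n vs = (if Suc n < length vs then vs[n := vs ! Suc n, Suc n := vs ! n] else vs)"

lemma swap_adj_append: "swap_adj (length xs) (xs @ a # b # ys) = xs @ b # a # ys"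
  by (simp add: swap_adj_def list_update_append nth_append)

lemma swap_adj_swap_adj: "swap_adj n (swap_adj n vs) = vs"
  by (auto simp: swap_adj_def list_eq_iff_nth_eq nth_list_update)

lemma map_swap_adj: "map p (swap_adj n vs) = swap_adj n (map p vs)"
  by (simp add: swap_adj_def map_update)

lemma split_at_adjacent:
  assumes "Suc n < length vs"
  obtains xs a b ys where "vs = xs @ a # b # ys" "length xs = n"
proof
  show "vs = take n vs @ vs ! n # vs ! Suc n # drop (Suc (Suc n)) vs"
    using assms by (metis Cons_nth_drop_Suc Suc_lessD append_take_drop_id)
  show "length (take n vs) = n"
    using assms by simp
qed

lemma oriented_chainsD:
  assumes "c \<in> oriented_chains k K"
  shows "finite {vs. c vs \<noteq> 0}"
    and "\<And>vs. c vs \<noteq> 0 \<Longrightarrow> length vs = Suc k"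
    and "\<And>vs. c vs \<noteq> 0 \<Longrightarrow> distinct vs"
    and "\<And>vs. c vs \<noteq> 0 \<Longrightarrow> set vs \<in> K"
    and "\<And>xs a b ys. c (xs @ a # b # ys) = - c (xs @ b # a # ys)"
  using assms unfolding oriented_chains_def by blast+

lemma oriented_chainsI:
  assumes "finite {vs. c vs \<noteq> 0}"
    and "\<And>vs. c vs \<noteq> 0 \<Longrightarrow> length vs = Suc k \<and> distinct vs \<and> set vs \<in> K"
    and "\<And>xs a b ys. c (xs @ a # b # ys) = - c (xs @ b # a # ys)"
  shows "c \<in> oriented_chains k K"
  using assms unfolding oriented_chains_def by blast

lemma oriented_chain_swap_adj:
  assumes "c \<in> oriented_chains k K" "Suc n < length vs"
  shows "c (swap_adj n vs) = - c vs"
  using split_at_adjacent[OF assms(2)] oriented_chainsD(5)[OF assms(1)] swap_adj_append by metis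

text \<open>Adjacent swaps bring two equal entries together. That \<open>g\<close> vanishes there is
  a separate hypothesis, since antisymmetry yields only \<open>g ws = - g ws\<close>, which leaves
  2-torsion.\<close>

lemma antisymmetric_not_distinct:
  fixes g :: "'a list \<Rightarrow> 'g::ab_group_add"
  assumes swap: "\<And>xs a b ys. g (xs @ a # b # ys) = - g (xs @ b # a # ys)"
    and adj: "\<And>xs a ys. g (xs @ a # a # ys) = 0"
    and "\<not> distinct ws"
  shows "g ws = 0"
proof -
  have *: "g (xs @ a # ys @ a # zs) = 0" for xs a ys zs
  proof (induction ys arbitrary: xs)
    case Nil
    then show ?case using adj by simp
  next
    case (Cons y ys)
    have "g (xs @ a # y # ys @ a # zs) = - g ((xs @ [y]) @ a # ys @ a # zs)"
      using swap[of xs a y "ys @ a # zs"] by simp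
    then show ?case using Cons[of "xs @ [y]"] by simp
  qed
  from not_distinct_decomp[OF assms(3)] obtain xs ys zs y where "ws = xs @ [y] @ ys @ [y] @ zs"
    by blast
  then show ?thesis using *[of xs y ys zs] by simp
qed

text \<open>Swapping two adjacent entries carries the support of \<open>c\<close> over a list
  bijectively to the support over the swapped list and reverses signs. If the two image entries are
  equal, this acts on a single fibre, without fixed points because lists in the support of
  \<open>c\<close> are distinct, and the terms cancel.\<close>

lemma push_chain_in_oriented_chains:
  assumes c: "c \<in> oriented_chains k K"
    and simplicial: "\<And>\<sigma>. \<sigma> \<in> K \<Longrightarrow> p ` \<sigma> \<in> L"
  shows "push_chain p c \<in> oriented_chains k L"
proof -
  note cD = oriented_chainsD[OF c]
  have fibre_fin: "finite {vs. map p vs = ws \<and> c vs \<noteq> 0}" for ws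
    by (rule finite_subset[OF _ cD(1)]) auto
  have swap: "push_chain p c (xs @ a # b # ys) = - push_chain p c (xs @ b # a # ys)" for xs a b ys
  proof -
    let ?n = "length xs"
    let ?A = "\<lambda>ws. {vs. map p vs = ws \<and> c vs \<noteq> 0}"
    have len: "Suc ?n < length vs" if "map p vs = xs @ a # b # ys" for vs a b
      using arg_cong[OF that, of length] by simp
    have "?A (xs @ b # a # ys) = swap_adj ?n ` ?A (xs @ a # b # ys)"
    proof (intro equalityI subsetI)
      fix vs assume vs: "vs \<in> ?A (xs @ b # a # ys)"
      then have "swap_adj ?n vs \<in> ?A (xs @ a # b # ys)"
        using len[of vs b a] oriented_chain_swap_adj[OF c, of ?n vs]
        by (auto simp: map_swap_adj swap_adj_append)
      then show "vs \<in> swap_adj ?n ` ?A (xs @ a # b # ys)"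
        by (rule rev_image_eqI) (rule swap_adj_swap_adj[symmetric])
    next
      fix vs assume "vs \<in> swap_adj ?n ` ?A (xs @ a # b # ys)"
      then show "vs \<in> ?A (xs @ b # a # ys)"
        using len oriented_chain_swap_adj[OF c, of ?n]
        by (auto simp: map_swap_adj swap_adj_append)
    qed
    then have "push_chain p c (xs @ b # a # ys) = (\<Sum>vs\<in>?A (xs @ a # b # ys). c (swap_adj ?n vs))"
      unfolding push_chain_def
      by (simp add: sum.reindex inj_on_inverseI[where g = "swap_adj ?n"] swap_adj_swap_adj)
    also have "\<dots> = (\<Sum>vs\<in>?A (xs @ a # b # ys). - c vs)"
      using len oriented_chain_swap_adj[OF c, of ?n] by (intro sum.cong) auto
    finally show ?thesis
      by (simp add: push_chain_def sum_negf)
  qed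
  have adj: "push_chain p c (xs @ a # a # ys) = 0" for xs a ys
    unfolding push_chain_def
  proof (rule sum_sign_reversing_involution[OF fibre_fin, where h = "swap_adj (length xs)"])
    fix vs assume vs: "vs \<in> {vs. map p vs = xs @ a # a # ys \<and> c vs \<noteq> 0}"
    then have mp: "map p vs = xs @ a # a # ys" and nz: "c vs \<noteq> 0" by auto
    have len: "Suc (length xs) < length vs"
      using arg_cong[OF mp, of length] by simp
    have "c (swap_adj (length xs) vs) = - c vs"
      using oriented_chain_swap_adj[OF c len] .
    moreover have "swap_adj (length xs) vs \<noteq> vs"
    proof
      assume eq: "swap_adj (length xs) vs = vs"
      then have "vs ! length xs = vs ! Suc (length xs)"
        using len by (metis swap_adj_def nth_list_update_eq length_list_update)
      then show False
        using cD(3)[OF nz] len by (simp add: nth_eq_iff_index_eq)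
    qed
    ultimately show "swap_adj (length xs) vs \<in> {vs. map p vs = xs @ a # a # ys \<and> c vs \<noteq> 0} \<and>
        swap_adj (length xs) (swap_adj (length xs) vs) = vs \<and>
        swap_adj (length xs) vs \<noteq> vs \<and> c (swap_adj (length xs) vs) = - c vs"
      using nz mp by (simp add: map_swap_adj swap_adj_append swap_adj_swap_adj)
  qed
  have "length ws = Suc k \<and> distinct ws \<and> set ws \<in> L" if nz: "push_chain p c ws \<noteq> 0" for ws
  proof -
    obtain vs where "map p vs = ws" "c vs \<noteq> 0"
      using nz support_pushforward[of "map p" c] unfolding push_chain_eq by blast
    then show ?thesis
      using antisymmetric_not_distinct[of "push_chain p c", OF swap adj] nz cD(2,4) simplicial
      by force
  qed
  moreover have "finite {ws. push_chain p c ws \<noteq> 0}"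
    unfolding push_chain_eq
    by (rule finite_subset[OF support_pushforward finite_imageI[OF cD(1)]])
  ultimately show ?thesis
    using swap unfolding oriented_chains_def by blast
qed

lemma zero_in_oriented_chains: "(\<lambda>_. 0) \<in> oriented_chains k K"
  by (simp add: oriented_chains_def)

lemma add_in_oriented_chains:
  assumes "c \<in> oriented_chains k K" "c' \<in> oriented_chains k K"
  shows "(\<lambda>vs. c vs + c' vs) \<in> oriented_chains k K"
proof -
  note cD = oriented_chainsD[OF assms(1)] and c'D = oriented_chainsD[OF assms(2)]
  show ?thesis
  proof (rule oriented_chainsI)
    show "finite {vs. c vs + c' vs \<noteq> 0}"
      by (rule finite_subset[OF _ finite_UnI[OF cD(1) c'D(1)]]) auto
    show "length vs = Suc k \<and> distinct vs \<and> set vs \<in> K" if nz: "c vs + c' vs \<noteq> 0" for vs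
    proof (cases "c vs = 0")
      case True
      then have "c' vs \<noteq> 0" using nz by simp
      then show ?thesis using c'D(2-4) by blast
    next
      case False
      then show ?thesis using cD(2-4) by blast
    qed
    show "c (xs @ a # b # ys) + c' (xs @ a # b # ys) = - (c (xs @ b # a # ys) + c' (xs @ b # a # ys))"
      for xs a b ys
      unfolding cD(5)[of xs a b ys] c'D(5)[of xs a b ys] by simp
  qed
qed

lemma uminus_in_oriented_chains:
  assumes "c \<in> oriented_chains k K"
  shows "(\<lambda>vs. - c vs) \<in> oriented_chains k K"
proof (rule oriented_chainsI)
  fix xs ys a b
  show "- c (xs @ a # b # ys) = - (- c (xs @ b # a # ys))"
    unfolding oriented_chainsD(5)[OF assms, of xs a b ys] by simp
qed (use oriented_chainsD(1-4)[OF assms] in auto)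

text \<open>A \<open>k\<close>-chain has coefficients on simplices with \<open>k + 1\<close>
  vertices only. This will confine a bounding chain to simplices whose vertices all meet
  \<open>W\<close>.\<close>

lemma oriented_chains_subcomplex:
  assumes "c \<in> oriented_chains k K"
    and "\<And>\<sigma>. \<sigma> \<in> K \<Longrightarrow> card \<sigma> = Suc k \<Longrightarrow> \<sigma> \<in> K'"
  shows "c \<in> oriented_chains k K'"
proof (rule oriented_chainsI)
  fix vs assume "c vs \<noteq> 0"
  then have "length vs = Suc k" "distinct vs" "set vs \<in> K"
    using oriented_chainsD(2-4)[OF assms(1)] by blast+
  then show "length vs = Suc k \<and> distinct vs \<and> set vs \<in> K'"
    using assms(2) by (simp add: distinct_card)
qed (fact oriented_chainsD(1)[OF assms(1)] oriented_chainsD(5)[OF assms(1)])+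


section \<open>Boundaries and homology classes\<close>

lemma boundariesE:
  assumes "b \<in> boundaries k K"
  obtains c where "c \<in> oriented_chains (Suc k) K" "b = boundary c"
  using assms unfolding boundaries_def by blast

lemma boundariesI: "c \<in> oriented_chains (Suc k) K \<Longrightarrow> boundary c \<in> boundaries k K"
  unfolding boundaries_def by (rule imageI)

lemma zero_in_boundaries: "(\<lambda>_. 0) \<in> boundaries k K"
  using boundariesI[OF zero_in_oriented_chains, of k K] unfolding boundary_zero .

lemma add_in_boundaries:
  assumes "b \<in> boundaries k K" "b' \<in> boundaries k K"
  shows "(\<lambda>vs. b vs + b' vs) \<in> boundaries k K"
proof -
  obtain c c' where c: "c \<in> oriented_chains (Suc k) K" "b = boundary c"
    and c': "c' \<in> oriented_chains (Suc k) K" "b' = boundary c'"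
    using assms by (metis boundariesE)
  have "(\<lambda>vs. b vs + b' vs) = boundary (\<lambda>vs. c vs + c' vs)"
    unfolding c(2) c'(2) using oriented_chainsD(1)[OF c(1)] oriented_chainsD(1)[OF c'(1)]
    by (rule boundary_add[symmetric])
  then show ?thesis
    using boundariesI[OF add_in_oriented_chains[OF c(1) c'(1)]] by simp
qed

lemma uminus_in_boundaries:
  assumes "b \<in> boundaries k K"
  shows "(\<lambda>vs. - b vs) \<in> boundaries k K"
proof -
  obtain c where c: "c \<in> oriented_chains (Suc k) K" "b = boundary c"
    using assms by (rule boundariesE)
  show ?thesis
    unfolding c(2) boundary_uminus[symmetric]
    by (rule boundariesI[OF uminus_in_oriented_chains[OF c(1)]])
qed

lemma finite_support_boundaries:
  assumes "b \<in> boundaries k K"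
  shows "finite {vs. b vs \<noteq> 0}"
proof -
  obtain c where c: "b = boundary c" "finite {vs. c vs \<noteq> 0}"
    using assms by (metis boundariesE oriented_chainsD(1))
  then have "{vs. b vs \<noteq> 0} \<subseteq> tl ` {vs. c vs \<noteq> 0}"
    using support_pushforward[of tl c] by (auto simp: boundary_eq)
  then show ?thesis
    using c(2) by (meson finite_imageI finite_subset)
qed

lemma push_chain_in_boundaries:
  assumes "b \<in> boundaries k K"
    and "\<And>\<sigma>. \<sigma> \<in> K \<Longrightarrow> p ` \<sigma> \<in> L"
  shows "push_chain p b \<in> boundaries k L"
proof -
  obtain c where c: "c \<in> oriented_chains (Suc k) K" "b = boundary c"
    using assms(1) by (rule boundariesE)
  show ?thesis
    unfolding c(2) boundary_push_chain[OF oriented_chainsD(1)[OF c(1)], symmetric]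
    by (rule boundariesI[OF push_chain_in_oriented_chains[OF c(1) assms(2)]])
qed

lemma cycle_group_coset:
  "boundaries k K #>\<^bsub>cycle_group k K\<^esub> a = (\<lambda>b vs. b vs + a vs) ` boundaries k K"
  by (auto simp: r_coset_def cycle_group_def)

lemma coset_of_boundary:
  assumes "a \<in> boundaries k K"
  shows "boundaries k K #>\<^bsub>cycle_group k K\<^esub> a = boundaries k K"
proof -
  have "b \<in> (\<lambda>b vs. b vs + a vs) ` boundaries k K" if b: "b \<in> boundaries k K" for b
  proof
    show "b = (\<lambda>vs. (b vs + - a vs) + a vs)"
      by simp
    show "(\<lambda>vs. b vs + - a vs) \<in> boundaries k K"
      using add_in_boundaries[OF b uminus_in_boundaries[OF assms]] .
  qed
  then show ?thesis
    unfolding cycle_group_coset using add_in_boundaries[OF _ assms] by blast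
qed

lemma in_coset: "a \<in> boundaries k K #>\<^bsub>cycle_group k K\<^esub> a"
  unfolding cycle_group_coset using zero_in_boundaries by (force simp: image_iff)

text \<open>\<open>K\<close> is an arbitrary set of sets and need not be closed under faces, hence a
  simplex containing \<open>set ws\<close>.\<close>

lemma support_boundary_subset_simplex:
  assumes "c \<in> oriented_chains k K" "boundary c ws \<noteq> 0"
  shows "\<exists>\<sigma>\<in>K. set ws \<subseteq> \<sigma>"
proof -
  have "pushforward tl c ws \<noteq> 0"
    using assms(2) by (auto simp: boundary_eq split: if_splits)
  then obtain vs where vs: "tl vs = ws" "c vs \<noteq> 0"
    using support_pushforward[of tl c] by blast
  then have "set ws \<subseteq> set vs"
    by (cases vs) auto
  then show ?thesis
    using oriented_chainsD(4)[OF assms(1) vs(2)] by blast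
qed

lemma homology_class_coset:
  assumes "X \<in> carrier (simplicial_homology k K)"
  obtains a where "a \<in> oriented_chains k K" "X = boundaries k K #>\<^bsub>cycle_group k K\<^esub> a"
proof -
  obtain a where "a \<in> carrier (cycle_group k K)" "X = boundaries k K #>\<^bsub>cycle_group k K\<^esub> a"
    using assms unfolding simplicial_homology_def FactGroup_def RCOSETS_def by auto
  moreover have "carrier (cycle_group k K) \<subseteq> oriented_chains k K"
    unfolding cycle_group_def by auto
  ultimately show thesis
    using that by blast
qed

lemma homology_class_cases:
  assumes "X \<in> carrier (simplicial_homology k K)" "z \<in> X"
  obtains a b where "a \<in> oriented_chains k K" "b \<in> boundaries k K" "z = (\<lambda>vs. b vs + a vs)"
  using homology_class_coset[OF assms(1)] assms(2) unfolding cycle_group_coset by blast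

lemma homology_class_nonempty:
  assumes "X \<in> carrier (simplicial_homology k K)"
  shows "X \<noteq> {}"
proof -
  obtain a where "X = boundaries k K #>\<^bsub>cycle_group k K\<^esub> a"
    using assms by (rule homology_class_coset)
  then show ?thesis
    using in_coset[of a k K] by blast
qed

lemma homology_class_finite_support:
  assumes "X \<in> carrier (simplicial_homology k K)" "z \<in> X"
  shows "finite {vs. z vs \<noteq> 0}"
proof -
  obtain a b where ab: "a \<in> oriented_chains k K" "b \<in> boundaries k K" "z = (\<lambda>vs. b vs + a vs)"
    using homology_class_cases[OF assms] .
  show ?thesis
    unfolding ab(3)
    by (rule finite_subset[OF _
          finite_UnI[OF oriented_chainsD(1)[OF ab(1)] finite_support_boundaries[OF ab(2)]]]) auto
qed

text \<open>In a nerve, the vertices of simplices are nonempty sets. So two vertex maps that agree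
  on nonempty sets push a representative to the same chain.\<close>

lemma homology_class_support:
  assumes "X \<in> carrier (simplicial_homology k K)" "z \<in> X" "z vs \<noteq> 0"
  shows "\<exists>\<sigma>\<in>K. set vs \<subseteq> \<sigma>"
proof -
  obtain a b where ab: "a \<in> oriented_chains k K" "b \<in> boundaries k K" "z = (\<lambda>vs. b vs + a vs)"
    using homology_class_cases[OF assms(1,2)] .
  obtain c where c: "c \<in> oriented_chains (Suc k) K" "b = boundary c"
    using ab(2) unfolding boundaries_def by blast
  have "a vs \<noteq> 0 \<or> boundary c vs \<noteq> 0"
    using assms(3) ab(3) c(2) by auto
  then show ?thesis
    using oriented_chainsD(4)[OF ab(1)] support_boundary_subset_simplex[OF c(1)]
    by (meson order_refl)
qed

text \<open>\<open>boundaries k L\<close> is the zero class. For empty \<open>X\<close> the union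
  over representatives would be empty, which is not a coset.\<close>

lemma simplicial_induced_eq_boundaries:
  assumes "X \<noteq> {}" "\<And>z. z \<in> X \<Longrightarrow> push_chain p z \<in> boundaries k L"
  shows "simplicial_induced k L p X = boundaries k L"
  using assms by (simp add: simplicial_induced_def coset_of_boundary)

lemma push_chain_in_boundaries_if_simplicial_induced:
  assumes "simplicial_induced k L p X = boundaries k L" "z \<in> X"
  shows "push_chain p z \<in> boundaries k L"
  using assms in_coset unfolding simplicial_induced_def by fastforce


section \<open>Open extensions\<close>

text \<open>
  Points of the extension of \<open>V\<close> are so close to \<open>V\<close> that all their nearest points in \<open>Y\<close> lie in
  \<open>V\<close>. Hence extending the members of a cover does not create new simplices of the nerve.
\<close>

definition open_extension :: "'a::metric_space set \<Rightarrow> 'a set \<Rightarrow> 'a set" where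
  "open_extension Y V = (\<Union>(y, r)\<in>{(y, r). y \<in> V \<and> ball y r \<inter> Y \<subseteq> V}. ball y (r / 2))"

lemma open_open_extension: "open (open_extension Y V)"
  unfolding open_extension_def by (intro open_UN) auto

lemma subset_open_extension:
  assumes "openin (top_of_set Y) V"
  shows "V \<subseteq> open_extension Y V"
proof
  fix y assume y: "y \<in> V"
  then obtain e where "e > 0" "ball y e \<inter> Y \<subseteq> V"
    using assms by (auto simp: openin_contains_ball)
  with y show "y \<in> open_extension Y V"
    unfolding open_extension_def by (intro UN_I[of "(y, e)"]) auto
qed

lemma open_extension_Int: "open_extension Y V \<inter> Y \<subseteq> V"
proof
  fix x assume x: "x \<in> open_extension Y V \<inter> Y"
  then obtain y r where "ball y r \<inter> Y \<subseteq> V" "dist y x < r / 2"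
    unfolding open_extension_def by auto
  \<comment> \<open>The definition does not restrict \<open>r\<close> to positive values, but a
    point in the ball of radius \<open>r / 2\<close> forces \<open>r > 0\<close>.\<close>
  moreover from this have "dist y x < r"
    using zero_le_dist[of y x] by linarith
  ultimately show "x \<in> V"
    using x by auto
qed

text \<open>\<open>x\<close> lies within \<open>r / 2\<close> of some \<open>z\<close> in
  \<open>V\<close>, and \<open>y\<close> is no farther from \<open>x\<close> than \<open>z\<close>
  is. So \<open>y\<close> lies within \<open>r\<close> of \<open>z\<close>, which is why the
  definition halves the radius.\<close>

lemma nearest_point_in_open_extension:
  assumes "y \<in> Y" "\<And>z. z \<in> Y \<Longrightarrow> dist x y \<le> dist x z" "x \<in> open_extension Y V" "V \<subseteq> Y"
  shows "y \<in> V"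
proof -
  obtain z r where z: "z \<in> V" "ball z r \<inter> Y \<subseteq> V" "dist z x < r / 2"
    using assms(3) unfolding open_extension_def by auto
  have "dist x y \<le> dist x z"
    using assms(2,4) z(1) by blast
  moreover have "dist z y \<le> dist z x + dist x y"
    by (rule dist_triangle)
  ultimately have "dist z y < r"
    using z(3) by (simp add: dist_commute)
  then show ?thesis
    using z(2) assms(1) by auto
qed

text \<open>A single nearest point of the closed set \<open>Y\<close> to \<open>x\<close> lies in
  all members at once.\<close>

lemma Inter_open_extension:
  fixes Y :: "'a::heine_borel set"
  assumes "closed Y" "\<W> \<noteq> {}" "\<And>V. V \<in> \<W> \<Longrightarrow> V \<subseteq> Y"
    and "\<And>V. V \<in> \<W> \<Longrightarrow> x \<in> open_extension Y V"
  shows "\<Inter>\<W> \<noteq> {}"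
proof -
  obtain V where "V \<in> \<W>" using assms(2) by blast
  then have "Y \<noteq> {}"
    using assms(3,4) unfolding open_extension_def by fastforce
  then obtain y where "y \<in> Y" "\<forall>z\<in>Y. dist x y \<le> dist x z"
    using distance_attains_inf[OF assms(1)] by metis
  then have "y \<in> \<Inter>\<W>"
    using nearest_point_in_open_extension assms(3,4) by (metis InterI)
  then show ?thesis by blast
qed

section \<open>Covers of small order\<close>

text \<open>The infimum at scale 1 is at most the supremum, and the normalizing constant
  \<open>c\<close> is positive, so \<open>c * \<eta>\<close> is a threshold independent of
  \<open>S\<close>. The bound on the diameters is then dropped.\<close>

lemma hausdorff_measure_small_cover:
  assumes "\<eta> > (0::real)"
  shows "\<exists>\<delta>>0. \<forall>S::'a::metric_space set. hausdorff_measure d S < \<delta> \<longrightarrow>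
    (\<exists>A::nat \<Rightarrow> 'a set. S \<subseteq> (\<Union>i. A i) \<and> (\<forall>i. bounded (A i)) \<and>
      (\<Sum>i. if A i = {} then 0 else ennreal (diameter (A i) ^ d)) < ennreal \<eta>)"
proof -
  define c where "c = unit_ball_vol (real d) / 2 ^ d"
  have "c > 0"
    unfolding c_def by simp
  show ?thesis
  proof (intro exI[of _ "ennreal c * ennreal \<eta>"] conjI allI impI)
    show "ennreal c * ennreal \<eta> > 0"
      using \<open>c > 0\<close> assms by (simp add: ennreal_zero_less_mult_iff)
    fix S :: "'a set"
    let ?\<A> = "\<lambda>\<delta>::real. {A::nat \<Rightarrow> 'a set. S \<subseteq> (\<Union>i. A i) \<and> (\<forall>i. bounded (A i) \<and> diameter (A i) \<le> \<delta>)}"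
    let ?sum = "\<lambda>A::nat \<Rightarrow> 'a set. \<Sum>i. if A i = {} then 0 else ennreal (diameter (A i) ^ d)"
    assume less: "hausdorff_measure d S < ennreal c * ennreal \<eta>"
    have "(INF A\<in>?\<A> 1. ?sum A) \<le> (SUP \<delta>\<in>{0<..}. INF A\<in>?\<A> \<delta>. ?sum A)"
      by (rule SUP_upper) simp
    also have "\<dots> < ennreal \<eta>"
    proof (rule ccontr)
      assume "\<not> ?thesis"
      then have "ennreal c * ennreal \<eta> \<le> ennreal c * (SUP \<delta>\<in>{0<..}. INF A\<in>?\<A> \<delta>. ?sum A)"
        by (intro mult_left_mono) auto
      then show False
        using less unfolding hausdorff_measure_def c_def by simp
    qed
    finally obtain A where "A \<in> ?\<A> 1" "?sum A < ennreal \<eta>"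
      unfolding INF_less_iff by blast
    then show "\<exists>A. S \<subseteq> (\<Union>i. A i) \<and> (\<forall>i. bounded (A i)) \<and> ?sum A < ennreal \<eta>"
      by blast
  qed
qed

text \<open>
  Almost every choice of radii works: a set of diameter \<open>t\<close> meets a given sphere only for radii in an
  interval of length \<open>2 * t\<close>, so it meets \<open>d\<close> given spheres on a set of radii of measure at most a
  constant times \<open>t ^ d\<close>, and these contributions add up to less than the total measure.
\<close>

lemma generic_radii:
  fixes x :: "nat \<Rightarrow> 'a::metric_space"
  assumes "\<epsilon> > 0"
  shows "\<exists>\<delta>>0. \<forall>S. hausdorff_measure d S < \<delta> \<longrightarrow>
    (\<exists>r. (\<forall>j<N. \<epsilon> \<le> r j \<and> r j \<le> 2 * \<epsilon>) \<and>
      (\<forall>I. I \<subseteq> {..<N} \<and> card I = d \<longrightarrow> (\<forall>y\<in>S. \<exists>i\<in>I. dist y (x i) \<noteq> r i)))"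
proof -
  define \<I> where "\<I> = {I. I \<subseteq> {..<N} \<and> card I = d}"
  have fin_\<I>: "finite \<I>"
    by (rule finite_subset[of _ "Pow {..<N}"]) (auto simp: \<I>_def)
  \<comment> \<open>\<open>K * t ^ d\<close> is the total volume of the bad boxes due to one
    nonempty set of diameter \<open>t\<close>: for each of the \<open>card \<I>\<close> choices of
    \<open>d\<close> spheres, \<open>d\<close> sides have length \<open>2 * t\<close> and
    \<open>N - d\<close> have length \<open>\<epsilon>\<close>. With the summand 1 in
    \<open>\<eta>\<close>, the total stays strictly below the volume \<open>\<epsilon> ^ N\<close>
    of the box of radii.\<close>
  define K where "K = real (card \<I>) * (2 ^ d * \<epsilon> ^ (N - d))"
  have "K \<ge> 0"
    unfolding K_def using assms by simp
  define \<eta> where "\<eta> = \<epsilon> ^ N / (K + 1)"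
  have "\<eta> > 0"
    unfolding \<eta>_def using assms \<open>K \<ge> 0\<close> by simp
  have "K * \<eta> < \<epsilon> ^ N"
    unfolding \<eta>_def using assms \<open>K \<ge> 0\<close> by (simp add: field_simps)
  obtain \<delta> where "\<delta> > 0" and \<delta>: "\<And>S::'a set. hausdorff_measure d S < \<delta> \<Longrightarrow>
    \<exists>A::nat \<Rightarrow> 'a set. S \<subseteq> (\<Union>i. A i) \<and> (\<forall>i. bounded (A i)) \<and>
      (\<Sum>i. if A i = {} then 0 else ennreal (diameter (A i) ^ d)) < ennreal \<eta>"
    using hausdorff_measure_small_cover[OF \<open>\<eta> > 0\<close>, of d] by blast
  show ?thesis
  proof (intro exI[of _ \<delta>] conjI allI impI)
    fix S :: "'a set"
    assume "hausdorff_measure d S < \<delta>"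
    then obtain A :: "nat \<Rightarrow> 'a set" where A: "S \<subseteq> (\<Union>i. A i)" "\<And>i. bounded (A i)"
      and small: "(\<Sum>i. if A i = {} then 0 else ennreal (diameter (A i) ^ d)) < ennreal \<eta>"
      using \<delta> by metis
    interpret product_sigma_finite "\<lambda>_::nat. lborel :: real measure"
      by standard
    let ?P = "Pi\<^sub>M {..<N} (\<lambda>_. lborel :: real measure)"
    define Box where "Box = ({..<N} \<rightarrow>\<^sub>E {\<epsilon>..2 * \<epsilon>})"
    define a where "a m = (SOME y. y \<in> A m)" for m
    define J where "J m j = {dist (a m) (x j) - diameter (A m)..dist (a m) (x j) + diameter (A m)}" for m j
    \<comment> \<open>This contains all admissible radii for which a point of \<open>A m\<close>
      lies on every sphere with index in \<open>I\<close>. The case of empty \<open>A m\<close>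
      matters for \<open>d = 0\<close>, where the product would be the full box although an empty
      set counts 0.\<close>
    define Bad where "Bad I m = (if A m = {} then {}
      else Pi\<^sub>E {..<N} (\<lambda>j. if j \<in> I then J m j else {\<epsilon>..2 * \<epsilon>}))" for I m
    have sets_Bad: "Bad I m \<in> sets ?P" for I m
      unfolding Bad_def J_def by (auto intro!: sets_PiM_I_finite)
    have sets_UN_Bad: "(\<Union>I\<in>\<I>. Bad I m) \<in> sets ?P" for m
      using sets_Bad fin_\<I> by (intro sets.finite_UN) auto
    have emeasure_Box: "emeasure ?P Box = ennreal (\<epsilon> ^ N)"
      unfolding Box_def using assms by (subst emeasure_PiM) (auto simp: ennreal_power)
    have emeasure_Bad: "emeasure ?P (Bad I m) =
        ennreal (2 ^ d * \<epsilon> ^ (N - d)) * (if A m = {} then 0 else ennreal (diameter (A m) ^ d))"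
      if I: "I \<in> \<I>" for I m
    proof (cases "A m = {}")
      case False
      have I': "I \<subseteq> {..<N}" "card I = d"
        using I by (auto simp: \<I>_def)
      have diam: "diameter (A m) \<ge> 0"
        using A(2) by (rule diameter_ge_0)
      have "emeasure ?P (Bad I m) =
          (\<Prod>j<N. emeasure lborel (if j \<in> I then J m j else {\<epsilon>..2 * \<epsilon>}))"
        unfolding Bad_def using False by (simp add: J_def emeasure_PiM)
      also have "\<dots> = (\<Prod>j<N. if j \<in> I then ennreal (2 * diameter (A m)) else ennreal \<epsilon>)"
        unfolding J_def using diam assms by (intro prod.cong) auto
      also have "\<dots> = (\<Prod>j\<in>{..<N} \<inter> I. ennreal (2 * diameter (A m))) * (\<Prod>j\<in>{..<N} - I. ennreal \<epsilon>)"
        by (subst prod.If_cases) (auto simp: Diff_eq)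
      also have "\<dots> = ennreal (2 * diameter (A m)) ^ d * ennreal \<epsilon> ^ (N - d)"
        using I' by (simp add: Int_absorb1 card_Diff_subset finite_subset)
      also have "\<dots> = ennreal ((2 * diameter (A m)) ^ d * \<epsilon> ^ (N - d))"
        using diam assms by (subst (1 2) ennreal_power) (simp_all add: ennreal_mult[symmetric] del: ennreal_power)
      also have "(2 * diameter (A m)) ^ d * \<epsilon> ^ (N - d) = 2 ^ d * \<epsilon> ^ (N - d) * diameter (A m) ^ d"
        by (simp add: power_mult_distrib)
      also have "ennreal \<dots> = ennreal (2 ^ d * \<epsilon> ^ (N - d)) * ennreal (diameter (A m) ^ d)"
        using diam assms by (intro ennreal_mult) auto
      finally show ?thesis
        using False by simp
    qed (simp add: Bad_def)
    have "\<exists>r\<in>Box. \<forall>I\<in>\<I>. \<forall>m. r \<notin> Bad I m"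
    proof (rule ccontr)
      assume "\<not> ?thesis"
      then have "Box \<subseteq> (\<Union>m. \<Union>I\<in>\<I>. Bad I m)"
        by blast
      then have "emeasure ?P Box \<le> emeasure ?P (\<Union>m. \<Union>I\<in>\<I>. Bad I m)"
        using sets_UN_Bad by (intro emeasure_mono sets.countable_UN) auto
      also have "\<dots> \<le> (\<Sum>m. emeasure ?P (\<Union>I\<in>\<I>. Bad I m))"
        using sets_UN_Bad by (intro emeasure_subadditive_countably) auto
      also have "\<dots> \<le> (\<Sum>m. \<Sum>I\<in>\<I>. emeasure ?P (Bad I m))"
        using sets_Bad fin_\<I> by (intro suminf_le emeasure_subadditive_finite) auto
      also have "\<dots> = (\<Sum>m. ennreal K * (if A m = {} then 0 else ennreal (diameter (A m) ^ d)))"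
        using assms unfolding K_def
        by (intro suminf_cong) (simp add: emeasure_Bad ennreal_mult ennreal_of_nat_eq_real_of_nat mult.assoc)
      also have "\<dots> = ennreal K * (\<Sum>m. if A m = {} then 0 else ennreal (diameter (A m) ^ d))"
        by simp
      also have "\<dots> \<le> ennreal K * ennreal \<eta>"
        using small by (intro mult_left_mono) auto
      also have "\<dots> < ennreal (\<epsilon> ^ N)"
        using \<open>K * \<eta> < \<epsilon> ^ N\<close> \<open>K \<ge> 0\<close> \<open>\<eta> > 0\<close> by (simp add: ennreal_mult[symmetric] ennreal_less_iff)
      finally show False
        using emeasure_Box by simp
    qed
    then obtain r where r: "r \<in> Box" "\<And>I m. I \<in> \<I> \<Longrightarrow> r \<notin> Bad I m"
      by blast
    have "\<exists>i\<in>I. dist y (x i) \<noteq> r i" if I: "I \<subseteq> {..<N}" "card I = d" and y: "y \<in> S" for I y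
    proof (rule ccontr)
      assume "\<not> ?thesis"
      then have eq: "dist y (x i) = r i" if "i \<in> I" for i
        using that by blast
      obtain m where m: "y \<in> A m"
        using A(1) y by blast
      then have "a m \<in> A m"
        unfolding a_def by (rule someI)
      then have "dist (a m) y \<le> diameter (A m)"
        using m A(2) by (intro diameter_bounded_bound)
      then have "r j \<in> J m j" if "j \<in> I" for j
        using eq[OF that] dist_triangle[of "a m" "x j" y] dist_triangle[of y "x j" "a m"]
        unfolding J_def by (auto simp: dist_commute)
      then have "r \<in> Bad I m"
        using r(1) m unfolding Bad_def Box_def by (auto simp: PiE_iff)
      then show False
        using r(2) I by (auto simp: \<I>_def)
    qed
    moreover have "\<forall>j<N. \<epsilon> \<le> r j \<and> r j \<le> 2 * \<epsilon>"
      using r(1) by (auto simp: Box_def PiE_iff)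
    ultimately show "\<exists>r. (\<forall>j<N. \<epsilon> \<le> r j \<and> r j \<le> 2 * \<epsilon>) \<and>
      (\<forall>I. I \<subseteq> {..<N} \<and> card I = d \<longrightarrow> (\<forall>y\<in>S. \<exists>i\<in>I. dist y (x i) \<noteq> r i))"
      by blast
  qed fact
qed

text \<open>The sum of the deviations is continuous and positive on \<open>S\<close>, so it has a
  positive minimum. Some term is at least the mean, and division by \<open>card I + 1\<close> makes
  \<tau> strictly smaller than that.\<close>

lemma compact_avoids_spheres_uniformly:
  fixes x :: "'i \<Rightarrow> 'a::metric_space"
  assumes "compact S" "finite I" "\<And>y. y \<in> S \<Longrightarrow> \<exists>i\<in>I. dist y (x i) \<noteq> r i"
  shows "\<exists>\<tau>>0. \<forall>y\<in>S. \<exists>i\<in>I. \<bar>dist y (x i) - r i\<bar> > \<tau>"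
proof (cases "S = {}")
  case True
  then show ?thesis by (intro exI[of _ 1]) auto
next
  case False
  let ?f = "\<lambda>y. \<Sum>i\<in>I. \<bar>dist y (x i) - r i\<bar>"
  obtain y0 where y0: "y0 \<in> S" "\<And>y. y \<in> S \<Longrightarrow> ?f y0 \<le> ?f y"
    using continuous_attains_inf[OF assms(1) False, of ?f] by (force intro!: continuous_intros)
  have pos: "?f y0 > 0"
    using assms(3)[OF y0(1)] assms(2) by (auto intro: sum_pos2)
  let ?\<tau> = "?f y0 / (real (card I) + 1)"
  have "\<exists>i\<in>I. \<bar>dist y (x i) - r i\<bar> > ?\<tau>" if "y \<in> S" for y
  proof (rule ccontr)
    assume "\<not> ?thesis"
    then have "?f y \<le> real (card I) * ?\<tau>"
      by (intro sum_bounded_above) force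
    also have "\<dots> < ?f y0"
      using pos by (simp add: field_simps)
    finally show False
      using y0(2)[OF that] by simp
  qed
  moreover have "?\<tau> > 0"
    using pos by simp
  ultimately show ?thesis by blast
qed

text \<open>
  The members of the cover are balls, from each of which slightly smaller concentric copies of the
  preceding ones are removed. A point in \<open>d + 1\<close> members is therefore close to the boundary spheres
  of \<open>d\<close> of the balls.
\<close>

lemma small_order_cover:
  fixes C :: "'a::metric_space set"
  assumes "compact C" "e > 0"
  shows "\<exists>\<delta>>0. \<forall>S. compact S \<and> hausdorff_measure d S < \<delta> \<longrightarrow>
    (\<exists>\<O>. finite \<O> \<and> (\<forall>U\<in>\<O>. open U \<and> (\<forall>a\<in>U. \<forall>b\<in>U. dist a b < e)) \<and> C \<subseteq> \<Union>\<O> \<and>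
      (\<forall>y\<in>S. card {U\<in>\<O>. y \<in> U} \<le> d))"
proof -
  \<comment> \<open>The balls will have radius \<open>r j + \<tau>\<close>, at most
    \<open>3 * \<epsilon>\<close>, so that two points of one are at distance less than
    \<open>6 * \<epsilon> = e\<close>.\<close>
  define \<epsilon> where "\<epsilon> = e / 6"
  have "\<epsilon> > 0"
    using assms(2) by (simp add: \<epsilon>_def)
  obtain X where X: "finite X" "C \<subseteq> (\<Union>p\<in>X. ball p \<epsilon>)"
    using assms(1) \<open>\<epsilon> > 0\<close> unfolding compact_eq_totally_bounded by blast
  obtain N :: nat and x where x: "X = x ` {..<N}"
    using finite_imp_nat_seg_image_inj_on[OF X(1)] unfolding lessThan_def by blast
  obtain \<delta> where "\<delta> > 0" and \<delta>: "\<And>S. hausdorff_measure d S < \<delta> \<Longrightarrow>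
    \<exists>r. (\<forall>j<N. \<epsilon> \<le> r j \<and> r j \<le> 2 * \<epsilon>) \<and>
      (\<forall>I. I \<subseteq> {..<N} \<and> card I = d \<longrightarrow> (\<forall>y\<in>S. \<exists>i\<in>I. dist y (x i) \<noteq> r i))"
    using generic_radii[OF \<open>\<epsilon> > 0\<close>, of d N x] by blast
  show ?thesis
  proof (intro exI[of _ \<delta>] conjI allI impI)
    fix S :: "'a set"
    assume S: "compact S \<and> hausdorff_measure d S < \<delta>"
    define \<I> where "\<I> = {I. I \<subseteq> {..<N} \<and> card I = d}"
    have fin_\<I>: "finite \<I>"
      by (rule finite_subset[of _ "Pow {..<N}"]) (auto simp: \<I>_def)
    obtain r where r: "\<forall>j<N. \<epsilon> \<le> r j \<and> r j \<le> 2 * \<epsilon>"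
      and "\<forall>I. I \<subseteq> {..<N} \<and> card I = d \<longrightarrow> (\<forall>y\<in>S. \<exists>i\<in>I. dist y (x i) \<noteq> r i)"
      using \<delta>[OF conjunct2[OF S]] by blast
    then have generic: "\<exists>i\<in>I. dist y (x i) \<noteq> r i" if "I \<in> \<I>" "y \<in> S" for I y
      using that unfolding \<I>_def by simp
    have "\<forall>I\<in>\<I>. \<exists>\<tau>>0. \<forall>y\<in>S. \<exists>i\<in>I. \<bar>dist y (x i) - r i\<bar> > \<tau>"
    proof
      fix I assume I: "I \<in> \<I>"
      then have "finite I"
        unfolding \<I>_def by (auto intro: finite_subset)
      then show "\<exists>\<tau>>0. \<forall>y\<in>S. \<exists>i\<in>I. \<bar>dist y (x i) - r i\<bar> > \<tau>"
        using compact_avoids_spheres_uniformly S generic[OF I] by blast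
    qed
    then obtain t where t: "\<And>I. I \<in> \<I> \<Longrightarrow> t I > 0"
      "\<And>I y. I \<in> \<I> \<Longrightarrow> y \<in> S \<Longrightarrow> \<exists>i\<in>I. \<bar>dist y (x i) - r i\<bar> > t I"
      by metis
    \<comment> \<open>Inserting \<epsilon> bounds \<tau> and keeps the minimum meaningful when there
      are no sets of \<open>d\<close> indices.\<close>
    define \<tau> where "\<tau> = Min (insert \<epsilon> (t ` \<I>))"
    have \<tau>: "\<tau> > 0" "\<tau> \<le> \<epsilon>" "\<And>I. I \<in> \<I> \<Longrightarrow> \<tau> \<le> t I"
      using fin_\<I> \<open>\<epsilon> > 0\<close> t(1) by (auto simp: \<tau>_def)
    define D where "D j = ball (x j) (r j + \<tau>) - (\<Union>i<j. cball (x i) (r i - \<tau>))" for j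
    show "\<exists>\<O>. finite \<O> \<and> (\<forall>U\<in>\<O>. open U \<and> (\<forall>a\<in>U. \<forall>b\<in>U. dist a b < e)) \<and> C \<subseteq> \<Union>\<O> \<and>
      (\<forall>y\<in>S. card {U\<in>\<O>. y \<in> U} \<le> d)"
    proof (intro exI[of _ "D ` {..<N}"] conjI ballI)
      show "finite (D ` {..<N})" by simp
      fix U assume "U \<in> D ` {..<N}"
      then obtain j where j: "j < N" "U = D j" by blast
      show "open U"
        unfolding j D_def by (intro open_Diff open_ball closed_UN) auto
      fix p q assume "p \<in> U" "q \<in> U"
      then have "dist (x j) p < r j + \<tau>" "dist (x j) q < r j + \<tau>"
        unfolding j D_def by auto
      then show "dist p q < e"
        using dist_triangle[of p q "x j"] r[rule_format, OF j(1)] \<tau>(2) by (simp add: dist_commute \<epsilon>_def)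
    next
      show "C \<subseteq> \<Union> (D ` {..<N})"
      proof
        fix y assume "y \<in> C"
        then obtain j where j: "j < N" "dist (x j) y < \<epsilon>"
          using X(2) x by auto
        \<comment> \<open>The first enlarged ball containing \<open>y\<close> is taken; the earlier
          enlarged balls miss \<open>y\<close>, and so do their shrunken copies.\<close>
        let ?Q = "\<lambda>j. j < N \<and> dist (x j) y < r j + \<tau>"
        have "?Q j"
          using j r[rule_format, OF j(1)] \<tau>(1) by auto
        then have Q: "?Q (LEAST j. ?Q j)"
          by (rule LeastI)
        have "y \<in> D (LEAST j. ?Q j)"
          unfolding D_def
        proof (intro DiffI)
          show "y \<in> ball (x (LEAST j. ?Q j)) (r (LEAST j. ?Q j) + \<tau>)"
            using Q by simp
          have "y \<notin> cball (x i) (r i - \<tau>)" if i: "i < (LEAST j. ?Q j)" for i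
          proof -
            have "i < N"
              using i Q by linarith
            then have "dist (x i) y \<ge> r i + \<tau>"
              using not_less_Least[OF i] by simp
            then show ?thesis
              using \<tau>(1) by simp
          qed
          then show "y \<notin> (\<Union>i<LEAST j. ?Q j. cball (x i) (r i - \<tau>))"
            by blast
        qed
        then show "y \<in> \<Union> (D ` {..<N})"
          using Q by blast
      qed
    next
      fix y assume y: "y \<in> S"
      let ?J = "{j. j < N \<and> y \<in> D j}"
      have "card ?J \<le> d"
      proof (rule ccontr)
        assume "\<not> ?thesis"
        then have "Suc d \<le> card ?J" by simp
        then obtain I where I: "I \<subseteq> ?J" "card I = Suc d"
          using obtain_subset_with_card_n by metis
        then have fin: "finite I" "I \<noteq> {}"
          by (auto intro: card_ge_0_finite)
        \<comment> \<open>For every other index \<open>i\<close>, membership in \<open>D i\<close>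
          bounds the distance from above and membership in \<open>D (Max I)\<close> from below. So
          \<open>y\<close> is \<tau>-close to \<open>d\<close> spheres.\<close>
        let ?I = "I - {Max I}"
        have "?I \<in> \<I>"
          using I fin by (auto simp: \<I>_def)
        then obtain i where i: "i \<in> ?I" "\<bar>dist y (x i) - r i\<bar> > \<tau>"
          using t(2)[OF _ y] \<tau>(3) by (meson order_le_less_trans)
        have "i < Max I"
          using i(1) fin by (metis DiffE Max_ge insertI1 order_le_less)
        moreover have "Max I \<in> ?J"
          using Max_in[OF fin] I(1) by blast
        ultimately have "dist (x i) y > r i - \<tau>"
          unfolding D_def by (force simp: not_le)
        moreover have "dist (x i) y < r i + \<tau>"
          using i(1) I(1) unfolding D_def by auto
        ultimately show False
          using i(2) by (simp add: dist_commute)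
      qed
      moreover have "card {U \<in> D ` {..<N}. y \<in> U} \<le> card (D ` ?J)"
        by (intro card_mono) auto
      moreover have "card (D ` ?J) \<le> card ?J"
        by (intro card_image_le) auto
      ultimately show "card {U \<in> D ` {..<N}. y \<in> U} \<le> d"
        by linarith
    qed
  qed fact
qed

section \<open>Limits of competitors\<close>

lemma nerveD:
  assumes "\<sigma> \<in> nerve \<U>"
  shows "finite \<sigma>" "\<sigma> \<noteq> {}" "\<sigma> \<subseteq> \<U>" "\<Inter>\<sigma> \<noteq> {}"
  using assms unfolding nerve_def by auto

lemma image_in_nerve:
  assumes "\<sigma> \<in> nerve \<U>" "\<And>U. U \<in> \<sigma> \<Longrightarrow> p U \<in> \<V> \<and> U \<subseteq> p U"
  shows "p ` \<sigma> \<in> nerve \<V>"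
proof -
  obtain x where "x \<in> \<Inter>\<sigma>"
    using nerveD(4)[OF assms(1)] by blast
  then have "x \<in> \<Inter>(p ` \<sigma>)"
    using assms(2) by blast
  then show ?thesis
    using nerveD(1-3)[OF assms(1)] assms(2) unfolding nerve_def by auto
qed

lemma one_cech_homology:
  "\<one>\<^bsub>cech_homology k X\<^esub> = (\<lambda>\<U>\<in>open_covers X. boundaries k (nerve \<U>))"
  by (simp add: cech_homology_def Let_def simplicial_homology_def FactGroup_def)

lemma cech_homologyD:
  assumes "x \<in> carrier (cech_homology k X)"
  shows "\<U> \<in> open_covers X \<Longrightarrow> x \<U> \<in> carrier (simplicial_homology k (nerve \<U>))"
    and "\<U> \<in> open_covers X \<Longrightarrow> \<V> \<in> open_covers X \<Longrightarrow> refines \<U> \<V> \<Longrightarrow>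
      refinement_map k \<U> \<V> (x \<U>) = x \<V>"
  using assms unfolding cech_homology_def Let_def by (auto simp: PiE_iff)

lemma open_covers_preimage_cover:
  assumes "X \<subseteq> Y" "\<V> \<in> open_covers (top_of_set Y)"
  shows "preimage_cover (top_of_set X) (\<lambda>y. y) \<V> \<in> open_covers (top_of_set X)"
proof -
  have "openin (top_of_set X) (V \<inter> X)" if "V \<in> \<V>" for V
  proof -
    have "openin (top_of_set Y) V"
      using assms(2) that unfolding open_covers_def by blast
    then obtain T where "open T" "V = Y \<inter> T"
      unfolding openin_open by blast
    then have "V \<inter> X = X \<inter> T"
      using assms(1) by blast
    then show ?thesis
      using \<open>open T\<close> by (auto simp: openin_open)
  qed
  then show ?thesis
    using assms unfolding open_covers_def preimage_cover_def by auto
qed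

lemma cech_induced_eq_one_iff:
  "cech_induced k X Y f x = \<one>\<^bsub>cech_homology k Y\<^esub> \<longleftrightarrow>
    (\<forall>\<V>\<in>open_covers Y. cech_induced k X Y f x \<V> = boundaries k (nerve \<V>))"
proof -
  have "cech_induced k X Y f x \<in> extensional (open_covers Y)"
    unfolding cech_induced_def by simp
  then show ?thesis
    unfolding one_cech_homology by (auto simp: fun_eq_iff extensional_def restrict_def)
qed

text \<open>This names the projection hidden in the choice operator, the same for all classes
  \<open>x\<close>, so that other vertex maps can be compared with it.\<close>

lemma cech_induced_projection:
  fixes \<V> :: "'a::topological_space set set" and k :: nat
  obtains q where "\<And>U. U \<in> preimage_cover (top_of_set X) (\<lambda>y. y) \<V> \<Longrightarrow> q U \<in> \<V> \<and> q U \<inter> X = U"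
    and "\<And>x :: 'a set set \<Rightarrow> ('a set list \<Rightarrow> 'g::ab_group_add) set.
      \<V> \<in> open_covers (top_of_set Y) \<Longrightarrow>
      cech_induced k (top_of_set X) (top_of_set Y) (\<lambda>y. y) x \<V> =
      simplicial_induced k (nerve \<V>) q (x (preimage_cover (top_of_set X) (\<lambda>y. y) \<V>))"
proof
  let ?P = "\<lambda>q. \<forall>U\<in>preimage_cover (top_of_set X) (\<lambda>y. y) \<V>.
    q U \<in> \<V> \<and> (\<lambda>y. y) -` q U \<inter> topspace (top_of_set X) = U"
  have "\<forall>U\<in>preimage_cover (top_of_set X) (\<lambda>y. y) \<V>.
    \<exists>V. V \<in> \<V> \<and> (\<lambda>y. y) -` V \<inter> topspace (top_of_set X) = U"
    unfolding preimage_cover_def by blast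
  then have "Ex ?P"
    by (rule bchoice)
  then have "?P (Eps ?P)"
    by (rule someI_ex)
  then show "Eps ?P U \<in> \<V> \<and> Eps ?P U \<inter> X = U"
    if "U \<in> preimage_cover (top_of_set X) (\<lambda>y. y) \<V>" for U
    using that by simp
qed (simp add: cech_induced_def)

lemma refinement_projection:
  fixes \<U> \<V> :: "'a set set" and k :: nat
  assumes "refines \<U> \<V>"
  obtains s where "\<And>U. U \<in> \<U> \<Longrightarrow> s U \<in> \<V> \<and> U \<subseteq> s U"
    and "\<And>X :: ('a set list \<Rightarrow> 'g::ab_group_add) set.
      refinement_map k \<U> \<V> X = simplicial_induced k (nerve \<V>) s X"
proof
  let ?P = "\<lambda>s. \<forall>U\<in>\<U>. s U \<in> \<V> \<and> U \<subseteq> s U"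
  have "Ex ?P"
    using assms unfolding refines_def by (intro bchoice) blast
  then have "?P (Eps ?P)"
    by (rule someI_ex)
  then show "Eps ?P U \<in> \<V> \<and> U \<subseteq> Eps ?P U" if "U \<in> \<U>" for U
    using that by blast
qed (simp add: refinement_map_def)

lemma open_covers_subset:
  assumes "\<V> \<in> open_covers (top_of_set Y)" "V \<in> \<V>"
  shows "V \<subseteq> Y" "V \<subseteq> open_extension Y V"
  using assms subset_open_extension unfolding open_covers_def by fastforce+

text \<open>Members of \<sigma> need to lie only in extensions of members of \<open>\<V>\<close>. A
  point of \<open>Y\<close> nearest to a common point of \<sigma> is common to the images.\<close>

lemma image_in_nerve_open_extension:
  fixes Y :: "'a::heine_borel set"
  assumes "closed Y" "\<V> \<in> open_covers (top_of_set Y)" "\<sigma> \<in> nerve \<U>"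
    and "\<And>U. U \<in> \<sigma> \<Longrightarrow> p U \<in> \<V> \<and> U \<subseteq> open_extension Y (p U)"
  shows "p ` \<sigma> \<in> nerve \<V>"
proof -
  obtain x where x: "x \<in> \<Inter>\<sigma>"
    using nerveD(4)[OF assms(3)] by blast
  have "\<Inter>(p ` \<sigma>) \<noteq> {}"
  proof (rule Inter_open_extension[OF assms(1)])
    show "p ` \<sigma> \<noteq> {}"
      using nerveD(2)[OF assms(3)] by simp
    show "V \<subseteq> Y" if "V \<in> p ` \<sigma>" for V
      using that assms(4) open_covers_subset(1)[OF assms(2)] by blast
    show "x \<in> open_extension Y V" if "V \<in> p ` \<sigma>" for V
      using that assms(4) x by blast
  qed
  then show ?thesis
    using nerveD(1-3)[OF assms(3)] assms(4) unfolding nerve_def by auto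
qed

text \<open>A Lebesgue number exists only for a compact part of \<open>Y\<close>, as \<Gamma> may be
  unbounded. The part within a ball slightly larger than one containing \<open>C\<close>
  suffices.\<close>

lemma uniform_neighbourhood:
  fixes Y C :: "'a::heine_borel set"
  assumes "closed Y" "compact C" "\<V> \<in> open_covers (top_of_set Y)"
  obtains W e where "open W" "Y \<subseteq> W" "e > 0"
    and "\<forall>U. (\<forall>a\<in>U. \<forall>b\<in>U. dist a b < e) \<and> U \<inter> W \<inter> C \<noteq> {} \<longrightarrow>
      (\<exists>V\<in>\<V>. U \<subseteq> open_extension Y V)"
proof -
  obtain p R where R: "\<And>c. c \<in> C \<Longrightarrow> dist p c \<le> R"
    using compact_imp_bounded[OF assms(2)] unfolding bounded_def by blast
  let ?K = "Y \<inter> cball p (R + 1)"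
  have "compact ?K"
    using assms(1) by (intro closed_Int_compact compact_cball)
  moreover have "?K \<subseteq> \<Union>(open_extension Y ` \<V>)"
  proof
    fix y assume "y \<in> ?K"
    then have "y \<in> \<Union>\<V>"
      using assms(3) unfolding open_covers_def by simp
    then show "y \<in> \<Union>(open_extension Y ` \<V>)"
      using open_covers_subset(2)[OF assms(3)] by blast
  qed
  ultimately obtain e where e: "e > 0" "\<And>y. y \<in> ?K \<Longrightarrow> \<exists>G\<in>open_extension Y ` \<V>. ball y e \<subseteq> G"
    by (rule Heine_Borel_lemma) (auto simp: open_open_extension)
  \<comment> \<open>A point of \<open>U\<close> is within \<open>e'\<close> of a point
    \<open>w\<close>, which is within \<open>e'\<close> of some \<open>y\<close> in
    \<open>Y\<close>, whence the half; the bound 1 keeps \<open>y\<close> in the compact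
    part.\<close>
  define e' where "e' = min e 1 / 2"
  have e': "e' > 0" "2 * e' \<le> e" "e' \<le> 1"
    using e(1) by (auto simp: e'_def)
  let ?W = "\<Union>y\<in>Y. ball y e'"
  have "\<exists>V\<in>\<V>. U \<subseteq> open_extension Y V"
    if U: "\<forall>a\<in>U. \<forall>b\<in>U. dist a b < e'" and meets: "U \<inter> ?W \<inter> C \<noteq> {}" for U
  proof -
    obtain w y where w: "w \<in> U" "w \<in> C" "y \<in> Y" "dist y w < e'"
      using meets by auto
    have "dist p y \<le> R + 1"
      using R[OF w(2)] dist_triangle[of p y w] w(4) e'(3) by (simp add: dist_commute)
    then obtain V where V: "V \<in> \<V>" "ball y e \<subseteq> open_extension Y V"
      using e(2)[of y] w(3) by auto
    have "dist y u < e" if "u \<in> U" for u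
      using dist_triangle[of y u w] U w(1,4) that e'(2) by fastforce
    then show ?thesis
      using V by (intro bexI[of _ V]) auto
  qed
  moreover have "Y \<subseteq> ?W"
    using e'(1) by force
  ultimately show thesis
    using e'(1) by (intro that[of ?W e']) auto
qed

text \<open>
  The cover \<open>\<U>\<close> of \<open>F \<union> \<Gamma>\<close> consists of sets near \<open>Y\<close> with the same traces on \<open>\<Gamma>\<close> as the members of
  \<open>\<V>\<close>, and of the traces of the members of \<open>\<O>\<close> on the complement of \<open>\<Gamma>\<close>. Each member of the first
  kind is so small that the projection \<open>p\<close> can be chosen to agree on the trace on \<open>\<Gamma>\<close>, as a map of
  vertices, with the projections \<open>s\<close> and \<open>q\<close> that occur in the inverse system; thus no contiguity
  argument is needed. A simplex having a vertex disjoint from \<open>W\<close> has all its vertices of the second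
  kind, so it has dimension at most \<open>k\<close>.
\<close>

lemma cech_induced_vanishes_on_cover:
  fixes Y \<Gamma> F :: "'a::heine_borel set"
    and x :: "'a set set \<Rightarrow> ('a set list \<Rightarrow> 'g::ab_group_add) set"
  assumes "closed Y" "closed \<Gamma>" "\<Gamma> \<subseteq> Y" "open W" "Y \<subseteq> W"
    and x: "x \<in> carrier (cech_homology k (top_of_set \<Gamma>))"
    and \<V>: "\<V> \<in> open_covers (top_of_set Y)"
    and "finite \<O>" "F \<subseteq> \<Union>\<O>" "\<And>U. U \<in> \<O> \<Longrightarrow> open U"
    and small: "\<And>U. U \<in> \<O> \<Longrightarrow> U \<inter> W \<inter> F \<noteq> {} \<Longrightarrow> \<exists>V\<in>\<V>. U \<subseteq> open_extension Y V"
    and order: "\<And>y. y \<in> F - W \<Longrightarrow> card {U\<in>\<O>. y \<in> U} \<le> Suc k"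
    and trivial: "cech_induced k (top_of_set \<Gamma>) (top_of_set (F \<union> \<Gamma>)) (\<lambda>y. y) x
      = \<one>\<^bsub>cech_homology k (top_of_set (F \<union> \<Gamma>))\<^esub>"
  shows "cech_induced k (top_of_set \<Gamma>) (top_of_set Y) (\<lambda>y. y) x \<V> = boundaries k (nerve \<V>)"
proof -
  let ?pre = "preimage_cover (top_of_set \<Gamma>) (\<lambda>y. y)"
  define \<W> where "\<W> = ?pre \<V>"
  have \<W>: "\<W> \<in> open_covers (top_of_set \<Gamma>)"
    unfolding \<W>_def using assms(3) \<V> by (rule open_covers_preimage_cover)
  obtain q where q: "\<And>U. U \<in> \<W> \<Longrightarrow> q U \<in> \<V> \<and> q U \<inter> \<Gamma> = U"
    and cech_q: "cech_induced k (top_of_set \<Gamma>) (top_of_set Y) (\<lambda>y. y) x \<V> =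
      simplicial_induced k (nerve \<V>) q (x \<W>)"
    using cech_induced_projection[of \<Gamma> \<V> Y k] \<V> unfolding \<W>_def by metis
  have class_\<W>: "x \<W> \<in> carrier (simplicial_homology k (nerve \<W>))"
    using cech_homologyD(1)[OF x \<W>] .
  have q_nerve: "q ` \<sigma> \<in> nerve \<V>" if "\<sigma> \<in> nerve \<W>" for \<sigma>
  proof (rule image_in_nerve[OF that])
    fix U assume "U \<in> \<sigma>"
    then show "q U \<in> \<V> \<and> U \<subseteq> q U"
      using q nerveD(3)[OF that] by blast
  qed
  have "push_chain q y \<in> boundaries k (nerve \<V>)" if y: "y \<in> x \<W>" for y
  \<comment> \<open>If \<open>\<V>\<close> is empty, so is \<open>\<W>\<close>, and a cover
    containing the empty set does not refine it.\<close>
  proof (cases "\<V> = {}")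
    case True
    have "y vs = 0" for vs
      using homology_class_support[OF class_\<W> y, of vs]
      by (auto simp: True \<W>_def preimage_cover_def nerve_def)
    then have "push_chain q y = (\<lambda>_. 0)"
      by (simp add: push_chain_def fun_eq_iff)
    then show ?thesis
      using zero_in_boundaries by simp
  next
    case False
    \<comment> \<open>The far sets have empty trace on \<Gamma>. Since \<open>\<U>\<close> contains
      the empty set in any case, its trace is exactly \<open>\<G>\<close>, even for empty
      \<open>\<O>\<close>.\<close>
    define \<G> where "\<G> = insert {} \<W>"
    have \<G>: "\<G> \<in> open_covers (top_of_set \<Gamma>)"
      using \<W> unfolding \<G>_def open_covers_def by auto
    have refines: "refines \<G> \<W>"
      using False unfolding refines_def \<G>_def \<W>_def preimage_cover_def by blast
    obtain s where s: "\<And>U. U \<in> \<G> \<Longrightarrow> s U \<in> \<W> \<and> U \<subseteq> s U"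
      and "refinement_map k \<G> \<W> (x \<G>) = simplicial_induced k (nerve \<W>) s (x \<G>)"
      using refinement_projection[OF refines, of k] by metis
    then have x_\<W>: "x \<W> = simplicial_induced k (nerve \<W>) s (x \<G>)"
      using cech_homologyD(2)[OF x \<G> \<W> refines] by simp
    have class_\<G>: "x \<G> \<in> carrier (simplicial_homology k (nerve \<G>))"
      using cech_homologyD(1)[OF x \<G>] .
    \<comment> \<open>The extension of \<open>q U\<close> makes the trace on \<Gamma> equal to
      \<open>U\<close>; that of \<open>q (s U)\<close> allows \<open>p\<close> to send the set to
      \<open>q (s U)\<close>.\<close>
    define near where
      "near U = (F \<union> \<Gamma>) \<inter> (open_extension Y (q U) \<inter> open_extension Y (q (s U)) \<inter> W)" for U
    define far where "far U = (F \<union> \<Gamma>) \<inter> (U - \<Gamma>)" for U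
    define \<U> where "\<U> = near ` \<W> \<union> far ` \<O> \<union> {{}}"
    have near_Int: "near U \<inter> \<Gamma> = U" if U: "U \<in> \<W>" for U
    proof
      show "near U \<inter> \<Gamma> \<subseteq> U"
        unfolding near_def using open_extension_Int[of Y "q U"] q[OF U] assms(3) by blast
      have "s U \<in> \<W>" "U \<subseteq> s U"
        using s[of U] U by (auto simp: \<G>_def)
      then have "U \<subseteq> q (s U)" "q (s U) \<in> \<V>"
        using q by blast+
      then show "U \<subseteq> near U \<inter> \<Gamma>"
        unfolding near_def using q[OF U] open_covers_subset(2)[OF \<V>] assms(3,5) by blast
    qed
    have \<U>: "\<U> \<in> open_covers (top_of_set (F \<union> \<Gamma>))"
    proof -
      have "openin (top_of_set (F \<union> \<Gamma>)) (near U)" for U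
        unfolding near_def using assms(4) by (intro openin_open_Int open_Int open_open_extension)
      moreover have "openin (top_of_set (F \<union> \<Gamma>)) (far U)" if "U \<in> \<O>" for U
        unfolding far_def using assms(2) assms(10)[OF that] by (intro openin_open_Int open_Diff)
      moreover have "\<Union>\<U> = F \<union> \<Gamma>"
      proof
        show "\<Union>\<U> \<subseteq> F \<union> \<Gamma>"
          unfolding \<U>_def near_def far_def by blast
        have "\<Gamma> \<subseteq> \<Union>\<U>"
        proof
          fix y assume "y \<in> \<Gamma>"
          then obtain U where "U \<in> \<W>" "y \<in> U"
            using \<W> unfolding open_covers_def by auto
          then show "y \<in> \<Union>\<U>"
            using near_Int[of U] unfolding \<U>_def by blast
        qed
        moreover have "F - \<Gamma> \<subseteq> \<Union>\<U>"
          unfolding \<U>_def far_def using assms(9) by blast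
        ultimately show "F \<union> \<Gamma> \<subseteq> \<Union>\<U>" by blast
      qed
      ultimately show ?thesis
        unfolding open_covers_def \<U>_def by auto
    qed
    have far_Int: "far U \<inter> \<Gamma> = {}" for U
      unfolding far_def by blast
    have pre_\<U>: "?pre \<U> = \<G>"
    proof -
      have "?pre \<U> = (\<lambda>U. U \<inter> \<Gamma>) ` \<U>"
        unfolding preimage_cover_def by simp
      also have "\<dots> = (\<lambda>U. near U \<inter> \<Gamma>) ` \<W> \<union> (\<lambda>U. far U \<inter> \<Gamma>) ` \<O> \<union> {{}}"
        unfolding \<U>_def by (simp add: image_Un image_image)
      also have "(\<lambda>U. near U \<inter> \<Gamma>) ` \<W> = \<W>"
        using near_Int by simp
      finally show ?thesis
        unfolding far_Int \<G>_def by auto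
    qed
    obtain q' where q': "\<And>U. U \<in> \<G> \<Longrightarrow> q' U \<in> \<U> \<and> q' U \<inter> \<Gamma> = U"
      and "cech_induced k (top_of_set \<Gamma>) (top_of_set (F \<union> \<Gamma>)) (\<lambda>y. y) x \<U> =
        simplicial_induced k (nerve \<U>) q' (x \<G>)"
      using cech_induced_projection[of \<Gamma> \<U> "F \<union> \<Gamma>" k] \<U> unfolding pre_\<U> by metis
    then have trivial_q': "simplicial_induced k (nerve \<U>) q' (x \<G>) = boundaries k (nerve \<U>)"
      using trivial \<U> unfolding cech_induced_eq_one_iff by simp
    \<comment> \<open>A set meeting \<Gamma> is a near set, and its trace recovers the member of
      \<open>\<W>\<close> it came from. The choice in the other case is meaningful only for sets
      meeting \<open>W\<close>.\<close>
    define p where "p U = (if U \<inter> \<Gamma> \<noteq> {} then q (s (U \<inter> \<Gamma>))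
      else SOME V. V \<in> \<V> \<and> U \<subseteq> open_extension Y V)" for U
    have p: "p U \<in> \<V> \<and> U \<subseteq> open_extension Y (p U)" if U: "U \<in> \<U>" "U \<inter> W \<noteq> {}" for U
    proof (cases "U \<inter> \<Gamma> = {}")
      case True
      have "\<exists>V. V \<in> \<V> \<and> U \<subseteq> open_extension Y V"
        using U(1) unfolding \<U>_def
      proof (elim UnE)
        assume "U \<in> near ` \<W>"
        then show ?thesis
          using q unfolding near_def by blast
      next
        assume "U \<in> far ` \<O>"
        then obtain B where "B \<in> \<O>" "U = far B" by blast
        then show ?thesis
          using small[of B] U(2) unfolding far_def by blast
      next
        assume "U \<in> {{}}"
        then show ?thesis
          using U(2) by blast
      qed
      then have "(SOME V. V \<in> \<V> \<and> U \<subseteq> open_extension Y V) \<in> \<V> \<and>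
        U \<subseteq> open_extension Y (SOME V. V \<in> \<V> \<and> U \<subseteq> open_extension Y V)"
        by (rule someI_ex)
      then show ?thesis
        by (simp add: p_def True)
    next
      case False
      then obtain T where T: "T \<in> \<W>" "U = near T"
        using U(1) far_Int unfolding \<U>_def by blast
      have "p U = q (s T)"
        using False near_Int[OF T(1)] by (simp add: p_def T(2))
      moreover have "s T \<in> \<W>"
        using s[of T] T(1) by (simp add: \<G>_def)
      ultimately show ?thesis
        using q unfolding T(2) near_def by auto
    qed
    define K where "K = {\<sigma> \<in> nerve \<U>. \<forall>U\<in>\<sigma>. U \<inter> W \<noteq> {}}"
    have p_nerve: "p ` \<sigma> \<in> nerve \<V>" if "\<sigma> \<in> K" for \<sigma>
    proof (rule image_in_nerve_open_extension[OF assms(1) \<V>])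
      show \<sigma>: "\<sigma> \<in> nerve \<U>"
        using that by (simp add: K_def)
      show "p U \<in> \<V> \<and> U \<subseteq> open_extension Y (p U)" if "U \<in> \<sigma>" for U
      proof (rule p)
        show "U \<in> \<U>"
          using nerveD(3)[OF \<sigma>] that by blast
        show "U \<inter> W \<noteq> {}"
          using \<open>\<sigma> \<in> K\<close> that unfolding K_def by blast
      qed
    qed
    have top_simplex: "\<sigma> \<in> K" if \<sigma>: "\<sigma> \<in> nerve \<U>" and card_\<sigma>: "card \<sigma> = Suc (Suc k)" for \<sigma>
    proof (rule ccontr)
      assume "\<sigma> \<notin> K"
      then obtain U where U: "U \<in> \<sigma>" "U \<inter> W = {}"
        using \<sigma> by (auto simp: K_def)
      obtain y where y: "y \<in> \<Inter>\<sigma>"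
        using nerveD(4)[OF \<sigma>] by blast
      then have "y \<notin> W"
        using U by blast
      \<comment> \<open>Near sets lie in \<open>W\<close> and the empty set has no points, so only
        far sets can contain \<open>y\<close>.\<close>
      have "\<sigma> \<subseteq> far ` {B \<in> \<O>. y \<in> B}"
      proof
        fix T assume T: "T \<in> \<sigma>"
        then have "y \<in> T" "T \<in> \<U>"
          using y nerveD(3)[OF \<sigma>] by blast+
        moreover from this have "T \<notin> near ` \<W>"
          using \<open>y \<notin> W\<close> unfolding near_def by blast
        ultimately show "T \<in> far ` {B \<in> \<O>. y \<in> B}"
          unfolding \<U>_def far_def by blast
      qed
      then have "card \<sigma> \<le> card {B \<in> \<O>. y \<in> B}"
        using assms(8) by (intro surj_card_le) auto
      moreover have "y \<in> F - W"
      proof -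
        have "U \<in> \<U>"
          using U(1) nerveD(3)[OF \<sigma>] by blast
        then have "U \<subseteq> F \<union> \<Gamma>"
          unfolding \<U>_def near_def far_def by blast
        then show ?thesis
          using y U(1) \<open>y \<notin> W\<close> assms(3,5) by blast
      qed
      ultimately show False
        using order card_\<sigma> by fastforce
    qed
    \<comment> \<open>Compatibility of \<open>x\<close> along the refinement of \<open>\<W>\<close>
      by \<open>\<G>\<close> lifts \<open>y\<close>, up to a boundary, to a representative
      \<open>z\<close> over \<open>\<G>\<close>.\<close>
    obtain z b where z: "z \<in> x \<G>" and b: "b \<in> boundaries k (nerve \<W>)"
      and y_eq: "y = (\<lambda>vs. b vs + push_chain s z vs)"
      using y unfolding x_\<W> simplicial_induced_def cycle_group_coset by blast
    have fin_z: "finite {vs. z vs \<noteq> 0}"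
      using homology_class_finite_support[OF class_\<G> z] .
    obtain c where c: "c \<in> oriented_chains (Suc k) (nerve \<U>)" "push_chain q' z = boundary c"
      using push_chain_in_boundaries_if_simplicial_induced[OF trivial_q' z] by (rule boundariesE)
    have c_K: "c \<in> oriented_chains (Suc k) K"
      using c(1) top_simplex by (rule oriented_chains_subcomplex)
    \<comment> \<open>The two maps may differ at the vertex \<open>{}\<close>, but no simplex
      contains it.\<close>
    have agree: "map (q \<circ> s) vs = map (p \<circ> q') vs" if nz: "z vs \<noteq> 0" for vs
    proof -
      obtain \<sigma> where \<sigma>: "\<sigma> \<in> nerve \<G>" "set vs \<subseteq> \<sigma>"
        using homology_class_support[OF class_\<G> z nz] by blast
      have "(q \<circ> s) U = (p \<circ> q') U" if "U \<in> set vs" for U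
      proof -
        have "U \<in> \<G>" "U \<noteq> {}"
          using \<sigma> that nerveD(3,4)[OF \<sigma>(1)] by blast+
        then show ?thesis
          using q' by (simp add: p_def)
      qed
      then show ?thesis by simp
    qed
    have "push_chain q (push_chain s z) = push_chain (q \<circ> s) z"
      unfolding push_chain_eq using fin_z by (simp add: pushforward_compose comp_def)
    also have "\<dots> = push_chain (p \<circ> q') z"
      unfolding push_chain_eq using agree by (rule pushforward_cong)
    also have "\<dots> = push_chain p (push_chain q' z)"
      unfolding push_chain_eq using fin_z by (simp add: pushforward_compose comp_def)
    also have "\<dots> \<in> boundaries k (nerve \<V>)"
      unfolding c(2) using boundariesI[OF c_K] p_nerve by (rule push_chain_in_boundaries)
    finally have "push_chain q (push_chain s z) \<in> boundaries k (nerve \<V>)" .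
    moreover have "push_chain q b \<in> boundaries k (nerve \<V>)"
      using b q_nerve by (rule push_chain_in_boundaries)
    moreover have "push_chain q y = (\<lambda>vs. push_chain q b vs + push_chain q (push_chain s z) vs)"
    proof -
      have "finite {vs. push_chain s z vs \<noteq> 0}"
        unfolding push_chain_eq
        by (rule finite_subset[OF support_pushforward finite_imageI[OF fin_z]])
      with finite_support_boundaries[OF b] show ?thesis
        unfolding y_eq push_chain_eq by (rule pushforward_add)
    qed
    ultimately show ?thesis
      by (simp add: add_in_boundaries)
  qed
  then show ?thesis
    unfolding cech_q using homology_class_nonempty[OF class_\<W>]
    by (intro simplicial_induced_eq_boundaries)
qed

theorem lemma2p5:
  fixes d :: nat
    and \<Gamma> E :: "(real ^ 'n) set"
    and Es :: "nat \<Rightarrow> (real ^ 'n) set"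
    and L :: "((real ^ 'n) set set \<Rightarrow> ((real ^ 'n) set list \<Rightarrow> 'g::ab_group_add) set) set"
  assumes "1 \<le> d" and "d \<le> CARD('n)"
    and "closed \<Gamma>"
    and "subgroup L (cech_homology (d - 1) (top_of_set \<Gamma>))"
    and "\<And>k. reifenberg_competitor d \<Gamma> L (Es k)"
    and "compact E"
    and "\<exists>C. compact C \<and> (\<forall>k. Es k \<subseteq> C)"
    and "\<And>V. open V \<Longrightarrow> E \<union> \<Gamma> \<subseteq> V \<Longrightarrow> (\<lambda>k. hausdorff_measure d (Es k - V)) \<longlonglongrightarrow> 0"
  shows "reifenberg_competitor d \<Gamma> L E"
  unfolding reifenberg_competitor_def cech_induced_eq_one_iff
proof (intro conjI ballI)
  show "compact E" by fact
  fix x \<V> assume "x \<in> L" and \<V>: "\<V> \<in> open_covers (top_of_set (E \<union> \<Gamma>))"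
  obtain C where C: "compact C" "\<And>k. Es k \<subseteq> C"
    using assms(7) by blast
  have closed: "closed (E \<union> \<Gamma>)"
    using assms(3,6) by (simp add: closed_Un compact_imp_closed)
  obtain W e where W: "open W" "E \<union> \<Gamma> \<subseteq> W" and "e > 0"
    and small: "\<forall>U. (\<forall>a\<in>U. \<forall>b\<in>U. dist a b < e) \<and> U \<inter> W \<inter> C \<noteq> {} \<longrightarrow>
      (\<exists>V\<in>\<V>. U \<subseteq> open_extension (E \<union> \<Gamma>) V)"
    using closed C(1) \<V> by (rule uniform_neighbourhood)
  obtain \<delta> where "\<delta> > 0" and \<delta>: "\<forall>S. compact S \<and> hausdorff_measure d S < \<delta> \<longrightarrow>
    (\<exists>\<O>. finite \<O> \<and> (\<forall>U\<in>\<O>. open U \<and> (\<forall>a\<in>U. \<forall>b\<in>U. dist a b < e)) \<and> C \<subseteq> \<Union>\<O> \<and>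
      (\<forall>y\<in>S. card {U\<in>\<O>. y \<in> U} \<le> d))"
    using small_order_cover[OF C(1) \<open>e > 0\<close>, of d] by (elim exE conjE)
  \<comment> \<open>\<delta> depends on \<open>\<V>\<close> through \<open>e\<close> but not on
    \<open>k\<close>, so a single index \<open>k\<close> suffices for this cover.\<close>
  have "\<forall>\<^sub>F k in sequentially. hausdorff_measure d (Es k - W) < \<delta>"
    using assms(8)[OF W] \<open>\<delta> > 0\<close> by (rule order_tendstoD)
  then obtain k where k: "hausdorff_measure d (Es k - W) < \<delta>"
    unfolding eventually_sequentially by blast
  have competitor: "compact (Es k)"
    "cech_induced (d - 1) (top_of_set \<Gamma>) (top_of_set (Es k \<union> \<Gamma>)) (\<lambda>y. y) x
      = \<one>\<^bsub>cech_homology (d - 1) (top_of_set (Es k \<union> \<Gamma>))\<^esub>"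
    using assms(5)[of k] \<open>x \<in> L\<close> unfolding reifenberg_competitor_def by auto
  have "compact (Es k - W)"
    using competitor(1) W(1) by (rule compact_diff)
  from \<delta>[rule_format, OF conjI, OF this k] obtain \<O> where \<O>: "finite \<O>"
    "\<forall>U\<in>\<O>. open U \<and> (\<forall>a\<in>U. \<forall>b\<in>U. dist a b < e)" "C \<subseteq> \<Union>\<O>"
    "\<forall>y\<in>Es k - W. card {U\<in>\<O>. y \<in> U} \<le> d"
    by (elim exE conjE)
  show "cech_induced (d - 1) (top_of_set \<Gamma>) (top_of_set (E \<union> \<Gamma>)) (\<lambda>y. y) x \<V>
      = boundaries (d - 1) (nerve \<V>)"
  proof (rule cech_induced_vanishes_on_cover[where F = "Es k" and W = W and \<O> = \<O>])
    show "x \<in> carrier (cech_homology (d - 1) (top_of_set \<Gamma>))"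
      using assms(4) \<open>x \<in> L\<close> by (rule subgroup.mem_carrier)
    show "Es k \<subseteq> \<Union>\<O>"
      using C(2)[of k] \<O>(3) by (rule subset_trans)
    show "\<exists>V\<in>\<V>. U \<subseteq> open_extension (E \<union> \<Gamma>) V" if "U \<in> \<O>" "U \<inter> W \<inter> Es k \<noteq> {}" for U
    proof (rule small[rule_format, OF conjI])
      show "\<forall>a\<in>U. \<forall>b\<in>U. dist a b < e"
        using bspec[OF \<O>(2) that(1)] by (rule conjunct2)
      show "U \<inter> W \<inter> C \<noteq> {}"
        using that(2) C(2)[of k] by blast
    qed
    \<comment> \<open>Since \<open>1 \<le> d\<close>, the bound is \<open>d\<close>, one less than
      the number of vertices of the \<open>d\<close>-simplices that bound in degree
      \<open>d - 1\<close>.\<close>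
    show "card {U \<in> \<O>. y \<in> U} \<le> Suc (d - 1)" if "y \<in> Es k - W" for y
      using bspec[OF \<O>(4) that] assms(1) by simp
  qed (use assms(3) closed W \<V> \<O>(1,2) competitor(2) in auto)
qed

end
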